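(* Let $R$ be a commutative Noetherian ring of finite Krull dimension and let $M$ be a finitely generated binary $R$-module without embedded primes. Then the annihilator $\operatorname{Ann}_R(M)$ is a radical ideal and $M$ is isomorphic, as an $R$-module, to an ideal of $R/\operatorname{Ann}_R(M)$. In particular, $\operatorname{End}_R(M)$ is a commutative, reduced ring.
   Context: For a prime $\mathfrak p$ of $R$, $\operatorname{finlen}(M_{\mathfrak p})$ denotes the length of the largest $R_{\mathfrak p}$-submodule of finite length of $M_{\mathfrak p}$; it is nonzero exactly when $\mathfrak p\in\operatorname{Ass}(M)$. $M$ is binary if $\operatorname{finlen}(M_{\mathfrak p})=1$ for every $\mathfrak p\in\operatorname{Ass}(M)$. An embedded prime of $M$ is an associated prime that is not minimal among the associated primes of $M$. *)

theory Defs
  imports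
    "HOL-Algebra.Module"
    "HOL-Algebra.QuotRing"
    "HOL-Algebra.Ring_Divisibility"
    "HOL-Library.Extended_Nat"
begin

section \<open>Rings and ideals\<close>

text \<open>For the zero ring the supremum is taken over the empty set, so its value is 0 here rather
  than \<open>-\<infinity>\<close>; this does not affect finiteness of the dimension.\<close>

definition krull_dim :: "('a, 'c) ring_scheme \<Rightarrow> enat"
  where "krull_dim R =
    (SUP n \<in> {n. \<exists>P. (\<forall>i\<le>n. primeideal (P i) R) \<and> (\<forall>i<n. P i \<subset> P (Suc i))}. enat n)"

definition ideal_radical :: "('a, 'c) ring_scheme \<Rightarrow> 'a set \<Rightarrow> 'a set"
  where "ideal_radical R I = {a \<in> carrier R. \<exists>n::nat. a [^]\<^bsub>R\<^esub> n \<in> I}"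

text \<open>The unit ideal counts as a radical ideal.\<close>

definition radical_ideal :: "'a set \<Rightarrow> ('a, 'c) ring_scheme \<Rightarrow> bool"
  where "radical_ideal I R \<longleftrightarrow> ideal I R \<and> ideal_radical R I = I"

definition reduced_ring :: "('a, 'c) ring_scheme \<Rightarrow> bool"
  where "reduced_ring R \<longleftrightarrow> ring R \<and>
    (\<forall>x \<in> carrier R. (\<exists>n::nat. x [^]\<^bsub>R\<^esub> n = \<zero>\<^bsub>R\<^esub>) \<longrightarrow> x = \<zero>\<^bsub>R\<^esub>)"

section \<open>Modules\<close>

definition submodule_span :: "('a, 'c) ring_scheme \<Rightarrow> ('a, 'b, 'd) module_scheme \<Rightarrow> 'b set \<Rightarrow> 'b set"
  where "submodule_span R M A = \<Inter>{N. submodule N R M \<and> A \<subseteq> N}"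

definition finitely_generated_module :: "('a, 'c) ring_scheme \<Rightarrow> ('a, 'b, 'd) module_scheme \<Rightarrow> bool"
  where "finitely_generated_module R M \<longleftrightarrow>
    (\<exists>A \<subseteq> carrier M. finite A \<and> submodule_span R M A = carrier M)"

definition elem_annihilator :: "('a, 'c) ring_scheme \<Rightarrow> ('a, 'b, 'd) module_scheme \<Rightarrow> 'b \<Rightarrow> 'a set"
  where "elem_annihilator R M x = {r \<in> carrier R. r \<odot>\<^bsub>M\<^esub> x = \<zero>\<^bsub>M\<^esub>}"

definition annihilator :: "('a, 'c) ring_scheme \<Rightarrow> ('a, 'b, 'd) module_scheme \<Rightarrow> 'a set"
  where "annihilator R M = {r \<in> carrier R. \<forall>x \<in> carrier M. r \<odot>\<^bsub>M\<^esub> x = \<zero>\<^bsub>M\<^esub>}"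

definition associated_primes :: "('a, 'c) ring_scheme \<Rightarrow> ('a, 'b, 'd) module_scheme \<Rightarrow> 'a set set"
  where "associated_primes R M =
    {P. primeideal P R \<and> (\<exists>x \<in> carrier M. P = elem_annihilator R M x)}"

definition embedded_primes :: "('a, 'c) ring_scheme \<Rightarrow> ('a, 'b, 'd) module_scheme \<Rightarrow> 'a set set"
  where "embedded_primes R M =
    {P \<in> associated_primes R M. \<exists>Q \<in> associated_primes R M. Q \<subset> P}"

definition module_length :: "('a, 'c) ring_scheme \<Rightarrow> ('a, 'b, 'd) module_scheme \<Rightarrow> enat"
  where "module_length R M =
    (SUP n \<in> {n. \<exists>C. (\<forall>i\<le>n. submodule (C i) R M) \<and> (\<forall>i<n. C i \<subset> C (Suc i))}. enat n)"

definition module_hom ::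
  "('a, 'c) ring_scheme \<Rightarrow> ('a, 'b, 'd) module_scheme \<Rightarrow> ('a, 'e, 'f) module_scheme \<Rightarrow> ('b \<Rightarrow> 'e) set"
  where "module_hom R M N = {f \<in> carrier M \<rightarrow> carrier N.
    (\<forall>x \<in> carrier M. \<forall>y \<in> carrier M. f (x \<oplus>\<^bsub>M\<^esub> y) = f x \<oplus>\<^bsub>N\<^esub> f y) \<and>
    (\<forall>r \<in> carrier R. \<forall>x \<in> carrier M. f (r \<odot>\<^bsub>M\<^esub> x) = r \<odot>\<^bsub>N\<^esub> f x)}"

definition module_isomorphic ::
  "('a, 'c) ring_scheme \<Rightarrow> ('a, 'b, 'd) module_scheme \<Rightarrow> ('a, 'e, 'f) module_scheme \<Rightarrow> bool"
  where "module_isomorphic R M N \<longleftrightarrow>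
    (\<exists>f \<in> module_hom R M N. bij_betw f (carrier M) (carrier N))"

text \<open>Endomorphisms are taken extensional, that is, undefined off \<open>carrier M\<close>, so that equal maps on
  the carrier are equal elements of the ring.\<close>

definition End_ring :: "('a, 'c) ring_scheme \<Rightarrow> ('a, 'b, 'd) module_scheme \<Rightarrow> ('b \<Rightarrow> 'b) ring"
  where "End_ring R M =
    \<lparr>carrier = module_hom R M M \<inter> extensional (carrier M),
     mult = (\<lambda>f g. compose (carrier M) f g),
     one = (\<lambda>x \<in> carrier M. x),
     zero = (\<lambda>x \<in> carrier M. \<zero>\<^bsub>M\<^esub>),
     add = (\<lambda>f g. \<lambda>x \<in> carrier M. f x \<oplus>\<^bsub>M\<^esub> g x)\<rparr>"

definition regular_module :: "('a, 'c) ring_scheme \<Rightarrow> ('a, 'a) module"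
  where "regular_module R =
    \<lparr>carrier = carrier R, mult = mult R, one = \<one>\<^bsub>R\<^esub>, zero = \<zero>\<^bsub>R\<^esub>, add = add R, smult = mult R\<rparr>"

text \<open>An ideal \<open>J\<close> of \<open>R/I\<close>, regarded as an \<open>R\<close>-module via \<open>R \<rightarrow> R/I\<close>.\<close>

definition quot_ideal_module :: "('a, 'c) ring_scheme \<Rightarrow> 'a set \<Rightarrow> 'a set set \<Rightarrow> ('a, 'a set) module"
  where "quot_ideal_module R I J =
    \<lparr>carrier = J, mult = mult (R Quot I), one = \<one>\<^bsub>R Quot I\<^esub>, zero = \<zero>\<^bsub>R Quot I\<^esub>,
     add = add (R Quot I), smult = (\<lambda>r A. (I +>\<^bsub>R\<^esub> r) \<otimes>\<^bsub>R Quot I\<^esub> A)\<rparr>"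

section \<open>Localization at a prime\<close>

text \<open>The class of \<open>x/s\<close> in \<open>S\<^sup>-\<^sup>1M\<close>. Operations on classes are given, as for \<^const>\<open>rcoset_mult\<close>, by
  the union over all representatives, all of which yield the same class.\<close>

definition fraction ::
  "('a, 'c) ring_scheme \<Rightarrow> ('a, 'b, 'd) module_scheme \<Rightarrow> 'a set \<Rightarrow> 'b \<Rightarrow> 'a \<Rightarrow> ('b \<times> 'a) set"
  where "fraction R M S x s =
    {(y, t). y \<in> carrier M \<and> t \<in> S \<and>
      (\<exists>u \<in> S. u \<odot>\<^bsub>M\<^esub> (t \<odot>\<^bsub>M\<^esub> x) = u \<odot>\<^bsub>M\<^esub> (s \<odot>\<^bsub>M\<^esub> y))}"

definition fractions ::
  "('a, 'c) ring_scheme \<Rightarrow> ('a, 'b, 'd) module_scheme \<Rightarrow> 'a set \<Rightarrow> ('b \<times> 'a) set set"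
  where "fractions R M S = {fraction R M S x s | x s. x \<in> carrier M \<and> s \<in> S}"

definition fraction_add ::
  "('a, 'c) ring_scheme \<Rightarrow> ('a, 'b, 'd) module_scheme \<Rightarrow> 'a set \<Rightarrow>
    ('b \<times> 'a) set \<Rightarrow> ('b \<times> 'a) set \<Rightarrow> ('b \<times> 'a) set"
  where "fraction_add R M S X Y =
    (\<Union>(x, s) \<in> X. \<Union>(y, t) \<in> Y. fraction R M S (t \<odot>\<^bsub>M\<^esub> x \<oplus>\<^bsub>M\<^esub> s \<odot>\<^bsub>M\<^esub> y) (s \<otimes>\<^bsub>R\<^esub> t))"

definition fraction_smult ::
  "('a, 'c) ring_scheme \<Rightarrow> ('a, 'b, 'd) module_scheme \<Rightarrow> 'a set \<Rightarrow>
    ('a \<times> 'a) set \<Rightarrow> ('b \<times> 'a) set \<Rightarrow> ('b \<times> 'a) set"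
  where "fraction_smult R M S A X =
    (\<Union>(a, s) \<in> A. \<Union>(x, t) \<in> X. fraction R M S (a \<odot>\<^bsub>M\<^esub> x) (s \<otimes>\<^bsub>R\<^esub> t))"

definition localized_ring :: "('a, 'c) ring_scheme \<Rightarrow> 'a set \<Rightarrow> ('a \<times> 'a) set ring"
  where "localized_ring R P = (let S = carrier R - P; RR = regular_module R in
    \<lparr>carrier = fractions R RR S,
     mult = fraction_smult R RR S,
     one = fraction R RR S \<one>\<^bsub>R\<^esub> \<one>\<^bsub>R\<^esub>,
     zero = fraction R RR S \<zero>\<^bsub>R\<^esub> \<one>\<^bsub>R\<^esub>,
     add = fraction_add R RR S\<rparr>)"

text \<open>The fields \<open>mult\<close> and \<open>one\<close>, which the record type provides for algebras, carry no meaning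
  for a module.\<close>

definition localized_module ::
  "('a, 'c) ring_scheme \<Rightarrow> ('a, 'b, 'd) module_scheme \<Rightarrow> 'a set \<Rightarrow> (('a \<times> 'a) set, ('b \<times> 'a) set) module"
  where "localized_module R M P = (let S = carrier R - P in
    \<lparr>carrier = fractions R M S,
     mult = undefined,
     one = undefined,
     zero = fraction R M S \<zero>\<^bsub>M\<^esub> \<one>\<^bsub>R\<^esub>,
     add = fraction_add R M S,
     smult = fraction_smult R M S\<rparr>)"

section \<open>Binary modules\<close>

definition largest_finite_length_submodule ::
  "('a, 'c) ring_scheme \<Rightarrow> ('a, 'b, 'd) module_scheme \<Rightarrow> 'b set"
  where "largest_finite_length_submodule R M =
    (GREATEST N. submodule N R M \<and> module_length R (M\<lparr>carrier := N\<rparr>) < \<infinity>)"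

definition finlen :: "('a, 'c) ring_scheme \<Rightarrow> ('a, 'b, 'd) module_scheme \<Rightarrow> enat"
  where "finlen R M = module_length R (M\<lparr>carrier := largest_finite_length_submodule R M\<rparr>)"

definition binary_module :: "('a, 'c) ring_scheme \<Rightarrow> ('a, 'b, 'd) module_scheme \<Rightarrow> bool"
  where "binary_module R M \<longleftrightarrow>
    (\<forall>P \<in> associated_primes R M. finlen (localized_ring R P) (localized_module R M P) = 1)"

end

theory Submission
  imports Defs
begin

text \<open>Every associated prime \<open>P\<close> of \<open>M\<close> is minimal over \<open>Ann M\<close>, so \<open>M\<^sub>P\<close> has finite length, and being
  binary means that \<open>M\<^sub>P\<close> is simple. Writing \<open>P = Ann y\<^sub>P\<close>, simplicity and finite generation yield
  \<open>v\<^sub>P \<notin> P\<close> with \<open>v\<^sub>P M \<subseteq> R y\<^sub>P\<close>. As \<open>v\<^sub>P P\<close> annihilates \<open>M\<close>, \<open>v\<^sub>P\<close> lies in all the other associated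
  primes; hence there are only finitely many of these, and \<open>v\<^sub>P y\<^sub>Q = 0\<close> for \<open>P \<noteq> Q\<close>. With \<open>x = \<Sum>\<^sub>P y\<^sub>P\<close> and
  \<open>s = \<Sum>\<^sub>P v\<^sub>P v\<^sub>P\<close>, multiplication by \<open>s\<close> is injective on \<open>M\<close>, because \<open>s\<close> avoids every associated
  prime, and \<open>s M \<subseteq> R x\<close>, because \<open>v\<^sub>P x = v\<^sub>P y\<^sub>P\<close>. Finally \<open>R x\<close> is isomorphic to \<open>R / Ann M\<close>, and an
  endomorphism \<open>f\<close> is determined by the \<open>a\<close> with \<open>s f(m) = a m\<close> for all \<open>m\<close>.\<close>

section \<open>Colon ideals over Noetherian rings\<close>

text \<open>In a Noetherian ring every nonempty chain of ideals contains its own union, so Zorn's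
  lemma applies to any nonempty family of ideals. The maximality arguments below, for colon ideals
  and for the finiteness of Ass, all rest on this.\<close>

lemma (in noetherian_ring) exists_maximal_ideal_in:
  assumes "\<F> \<noteq> {}" and "\<And>I. I \<in> \<F> \<Longrightarrow> ideal I R"
  obtains I where "I \<in> \<F>" and "\<And>J. J \<in> \<F> \<Longrightarrow> I \<subseteq> J \<Longrightarrow> J = I"
proof -
  have "\<exists>I\<in>\<F>. \<forall>J\<in>\<F>. I \<subseteq> J \<longrightarrow> J = I"
  proof (rule subset_Zorn_nonempty[OF assms(1)])
    fix C assume C: "C \<noteq> {}" "subset.chain \<F> C"
    then have "subset.chain {I. ideal I R} C" using assms(2) unfolding subset.chain_def by auto
    from ideal_chain_is_trivial[OF C(1) this] C(2) show "\<Union>C \<in> \<F>"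
      unfolding subset.chain_def by auto
  qed
  then show thesis using that by blast
qed

text \<open>The annihilator of the class of \<open>x\<close> in M/N. Colon ideals stand in for
  quotient modules throughout, so that M/N is never formed.\<close>

definition colon :: "('a, 'c) ring_scheme \<Rightarrow> ('a, 'b, 'd) module_scheme \<Rightarrow> 'b set \<Rightarrow> 'b \<Rightarrow> 'a set"
  where "colon R M N x = {r \<in> carrier R. r \<odot>\<^bsub>M\<^esub> x \<in> N}"

lemma submodule_zero_closed: "submodule N R M \<Longrightarrow> \<zero>\<^bsub>M\<^esub> \<in> N"
  using subgroup.one_closed[OF submodule.axioms(1), of N R M] by simp

lemma (in module) zero_submodule: "submodule {\<zero>\<^bsub>M\<^esub>} R M"
  by (rule submoduleI) auto

lemma (in module) smult_in_cyclic:
  "\<lbrakk>r \<in> carrier R; a \<in> (\<lambda>r. r \<odot>\<^bsub>M\<^esub> y) ` carrier R; y \<in> carrier M\<rbrakk> \<Longrightarrow>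
    r \<odot>\<^bsub>M\<^esub> a \<in> (\<lambda>r. r \<odot>\<^bsub>M\<^esub> y) ` carrier R"
  by (auto simp flip: smult_assoc1)

lemma (in module) cyclic_submodule:
  assumes "y \<in> carrier M"
  shows "submodule ((\<lambda>r. r \<odot>\<^bsub>M\<^esub> y) ` carrier R) R M"
proof (rule submoduleI)
  show "\<zero>\<^bsub>M\<^esub> \<in> (\<lambda>r. r \<odot>\<^bsub>M\<^esub> y) ` carrier R"
    using assms by (metis R.zero_closed image_eqI smult_l_null)
qed (use assms in \<open>auto simp: smult_in_cyclic simp flip: smult_l_distr smult_l_minus\<close>)

lemma (in module) sum_submodule:
  assumes N: "submodule N R M" and L: "submodule L R M"
  shows "submodule {x \<oplus>\<^bsub>M\<^esub> y | x y. x \<in> N \<and> y \<in> L} R M"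
proof (rule submoduleI)
  note NE = submoduleE[OF N] and LE = submoduleE[OF L]
  show "{x \<oplus>\<^bsub>M\<^esub> y | x y. x \<in> N \<and> y \<in> L} \<subseteq> carrier M" using NE(1) LE(1) by auto
  show "\<zero>\<^bsub>M\<^esub> \<in> {x \<oplus>\<^bsub>M\<^esub> y | x y. x \<in> N \<and> y \<in> L}"
    using submodule_zero_closed[OF N] submodule_zero_closed[OF L] by force
  show "\<ominus>\<^bsub>M\<^esub> a \<in> {x \<oplus>\<^bsub>M\<^esub> y | x y. x \<in> N \<and> y \<in> L}"
    if "a \<in> {x \<oplus>\<^bsub>M\<^esub> y | x y. x \<in> N \<and> y \<in> L}" for a
  proof -
    from that obtain x y where xy: "a = x \<oplus>\<^bsub>M\<^esub> y" "x \<in> N" "y \<in> L" by auto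
    with NE(1) LE(1) have "\<ominus>\<^bsub>M\<^esub> a = \<ominus>\<^bsub>M\<^esub> x \<oplus>\<^bsub>M\<^esub> \<ominus>\<^bsub>M\<^esub> y" by (simp add: M.minus_add subsetD)
    with xy NE(3) LE(3) show ?thesis by blast
  qed
  show "a \<oplus>\<^bsub>M\<^esub> b \<in> {x \<oplus>\<^bsub>M\<^esub> y | x y. x \<in> N \<and> y \<in> L}"
    if ab: "a \<in> {x \<oplus>\<^bsub>M\<^esub> y | x y. x \<in> N \<and> y \<in> L}" "b \<in> {x \<oplus>\<^bsub>M\<^esub> y | x y. x \<in> N \<and> y \<in> L}" for a b
  proof -
    from ab obtain x y x' y' where xy: "a = x \<oplus>\<^bsub>M\<^esub> y" "x \<in> N" "y \<in> L"
      "b = x' \<oplus>\<^bsub>M\<^esub> y'" "x' \<in> N" "y' \<in> L" by auto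
    with NE(1) LE(1) have "a \<oplus>\<^bsub>M\<^esub> b = (x \<oplus>\<^bsub>M\<^esub> x') \<oplus>\<^bsub>M\<^esub> (y \<oplus>\<^bsub>M\<^esub> y')" by (simp add: M.a_ac subsetD)
    with xy NE(5) LE(5) show ?thesis by blast
  qed
  show "r \<odot>\<^bsub>M\<^esub> a \<in> {x \<oplus>\<^bsub>M\<^esub> y | x y. x \<in> N \<and> y \<in> L}"
    if "r \<in> carrier R" "a \<in> {x \<oplus>\<^bsub>M\<^esub> y | x y. x \<in> N \<and> y \<in> L}" for r a
  proof -
    from that obtain x y where xy: "a = x \<oplus>\<^bsub>M\<^esub> y" "x \<in> N" "y \<in> L" by auto
    with NE(1) LE(1) that have "r \<odot>\<^bsub>M\<^esub> a = r \<odot>\<^bsub>M\<^esub> x \<oplus>\<^bsub>M\<^esub> r \<odot>\<^bsub>M\<^esub> y"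
      by (simp add: smult_r_distr subsetD)
    with xy NE(4) LE(4) that show ?thesis by blast
  qed
qed

lemma (in module) ideal_colon:
  assumes N: "submodule N R M" and x: "x \<in> carrier M"
  shows "ideal (colon R M N x) R"
proof (rule idealI)
  note NE = submoduleE[OF N]
  show "ring R" by (rule R.ring_axioms)
  show "subgroup (colon R M N x) (add_monoid R)"
  proof (rule R.add.subgroupI)
    show "colon R M N x \<noteq> {}"
      using x submodule_zero_closed[OF N] by (force simp: colon_def intro: exI[of _ \<zero>])
  qed (use x NE in \<open>auto simp: colon_def smult_l_distr smult_l_minus\<close>)
  show "r \<otimes> a \<in> colon R M N x" if "a \<in> colon R M N x" "r \<in> carrier R" for a r
    using that x NE(4) by (auto simp: colon_def smult_assoc1)
  then show "a \<otimes> r \<in> colon R M N x" if "a \<in> colon R M N x" "r \<in> carrier R" for a r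
    using that by (metis (no_types, lifting) R.m_comm colon_def mem_Collect_eq)
qed

text \<open>A maximal element among the proper colon ideals \<open>(N : r m)\<close> is prime.\<close>

lemma (in module) prime_colon:
  assumes noeth: "noetherian_ring R" and N: "submodule N R M"
    and m: "m \<in> carrier M" and mN: "m \<notin> N"
  obtains r where "r \<in> carrier R" and "r \<odot>\<^bsub>M\<^esub> m \<notin> N" and "primeideal (colon R M N (r \<odot>\<^bsub>M\<^esub> m)) R"
proof -
  interpret noetherian_ring R by (rule noeth)
  define F where "F = {colon R M N (r \<odot>\<^bsub>M\<^esub> m) | r. r \<in> carrier R \<and> r \<odot>\<^bsub>M\<^esub> m \<notin> N}"
  have "F \<noteq> {}" using m mN by (auto simp: F_def intro!: exI[of _ \<one>])
  moreover have "ideal I R" if "I \<in> F" for I using that ideal_colon[OF N] m by (auto simp: F_def)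
  ultimately obtain I where I: "I \<in> F" and max: "\<And>J. J \<in> F \<Longrightarrow> I \<subseteq> J \<Longrightarrow> J = I"
    using exists_maximal_ideal_in by metis
  from I obtain r where r: "r \<in> carrier R" "r \<odot>\<^bsub>M\<^esub> m \<notin> N" "I = colon R M N (r \<odot>\<^bsub>M\<^esub> m)"
    by (auto simp: F_def)
  have "primeideal I R"
  proof (rule primeidealI)
    show "ideal I R" using r ideal_colon[OF N] m by auto
    show "cring R" by (rule R.is_cring)
    have "\<one> \<notin> I" using r m by (simp add: colon_def)
    then show "carrier R \<noteq> I" by auto
    fix a b assume ab: "a \<in> carrier R" "b \<in> carrier R" "a \<otimes> b \<in> I"
    show "a \<in> I \<or> b \<in> I"
    proof (rule disjCI)
      assume b: "b \<notin> I"
      \<comment> \<open>Replacing \<open>r\<close> by \<open>b \<otimes> r\<close> stays within the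
        family, because \<open>b \<notin> I\<close>, and can only enlarge the colon ideal, so by
        maximality the ideal is still \<open>I\<close>. It contains \<open>a\<close> because
        \<open>a \<otimes> b \<in> I\<close>.\<close>
      have br: "(b \<otimes> r) \<odot>\<^bsub>M\<^esub> m = b \<odot>\<^bsub>M\<^esub> (r \<odot>\<^bsub>M\<^esub> m)" using ab r m by (simp add: smult_assoc1)
      have "(b \<otimes> r) \<odot>\<^bsub>M\<^esub> m \<notin> N" unfolding br using b ab r by (simp add: colon_def)
      then have J: "colon R M N ((b \<otimes> r) \<odot>\<^bsub>M\<^esub> m) \<in> F" using ab r by (auto simp: F_def)
      have "I \<subseteq> colon R M N ((b \<otimes> r) \<odot>\<^bsub>M\<^esub> m)"
      proof
        fix c assume "c \<in> I"
        then have c: "c \<in> carrier R" "c \<odot>\<^bsub>M\<^esub> (r \<odot>\<^bsub>M\<^esub> m) \<in> N" by (auto simp: r colon_def)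
        have "c \<odot>\<^bsub>M\<^esub> ((b \<otimes> r) \<odot>\<^bsub>M\<^esub> m) = b \<odot>\<^bsub>M\<^esub> (c \<odot>\<^bsub>M\<^esub> (r \<odot>\<^bsub>M\<^esub> m))"
          unfolding br using c ab r m
          by (metis R.m_comm smult_assoc1 smult_closed)
        then show "c \<in> colon R M N ((b \<otimes> r) \<odot>\<^bsub>M\<^esub> m)"
          using c ab submoduleE(4)[OF N] by (simp add: colon_def)
      qed
      with max[OF J] have "colon R M N ((b \<otimes> r) \<odot>\<^bsub>M\<^esub> m) = I" by simp
      moreover have "a \<odot>\<^bsub>M\<^esub> ((b \<otimes> r) \<odot>\<^bsub>M\<^esub> m) \<in> N"
        unfolding br using ab r m by (simp add: colon_def smult_assoc1)
      ultimately show "a \<in> I" using ab by (auto simp: colon_def)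
    qed
  qed
  then show thesis using r that by blast
qed

lemma (in module) colon_zero: "colon R M {\<zero>\<^bsub>M\<^esub>} x = elem_annihilator R M x"
  by (simp add: colon_def elem_annihilator_def)

lemma (in module) ideal_elem_annihilator:
  "x \<in> carrier M \<Longrightarrow> ideal (elem_annihilator R M x) R"
  using ideal_colon[OF zero_submodule] by (simp add: colon_zero)

lemma annihilator_subset_elem_annihilator:
  "x \<in> carrier M \<Longrightarrow> annihilator R M \<subseteq> elem_annihilator R M x"
  by (auto simp: annihilator_def elem_annihilator_def)

lemma (in module) ideal_annihilator: "ideal (annihilator R M) R"
proof -
  have "carrier M \<noteq> {}" by auto
  then have "annihilator R M = \<Inter>(elem_annihilator R M ` carrier M)"
    by (auto simp: annihilator_def elem_annihilator_def)
  also have "ideal \<dots> R"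
    by (rule R.i_Intersect) (use \<open>carrier M \<noteq> {}\<close> ideal_elem_annihilator in auto)
  finally show ?thesis .
qed

lemma submodule_span_minimal: "submodule N R M \<Longrightarrow> A \<subseteq> N \<Longrightarrow> submodule_span R M A \<subseteq> N"
  by (auto simp: submodule_span_def)

section \<open>Submodules saturated with respect to a prime\<close>

text \<open>For a prime \<open>P\<close>, these submodules of \<open>M\<close> correspond to the submodules of \<open>M\<^sub>P\<close>.\<close>

definition saturated :: "('a, 'c) ring_scheme \<Rightarrow> ('a, 'b, 'd) module_scheme \<Rightarrow> 'a set \<Rightarrow> 'b set \<Rightarrow> bool"
  where "saturated R M P N \<longleftrightarrow> submodule N R M \<and>
    (\<forall>u \<in> carrier R - P. \<forall>x \<in> carrier M. u \<odot>\<^bsub>M\<^esub> x \<in> N \<longrightarrow> x \<in> N)"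

text \<open>The preimage of \<open>N\<^sub>P\<close> under the canonical map from M to
  \<open>M\<^sub>P\<close>. For N = 0 it is the kernel of that map.\<close>

definition saturation :: "('a, 'c) ring_scheme \<Rightarrow> ('a, 'b, 'd) module_scheme \<Rightarrow> 'a set \<Rightarrow> 'b set \<Rightarrow> 'b set"
  where "saturation R M P N = {x \<in> carrier M. \<exists>u \<in> carrier R - P. u \<odot>\<^bsub>M\<^esub> x \<in> N}"

lemma saturatedD:
  assumes "saturated R M P N"
  shows "submodule N R M"
    and "\<And>u x. \<lbrakk>u \<in> carrier R; u \<notin> P; x \<in> carrier M; u \<odot>\<^bsub>M\<^esub> x \<in> N\<rbrakk> \<Longrightarrow> x \<in> N"
  using assms by (auto simp: saturated_def)

lemma (in primeideal) one_notin: "\<one> \<notin> I"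
  using I_notcarr one_imp_carrier by blast

lemma (in primeideal) mult_notin:
  "\<lbrakk>a \<in> carrier R; b \<in> carrier R; a \<notin> I; b \<notin> I\<rbrakk> \<Longrightarrow> a \<otimes> b \<notin> I"
  using I_prime by blast

text \<open>Finitely many multipliers can be replaced by their product: it avoids the prime, and it
  still carries each element into \<open>N\<close> because \<open>N\<close> is closed under
  scalars.\<close>

lemma (in primeideal) finite_common_multiplier:
  assumes M: "module R M" and N: "submodule N R M" and fin: "finite A"
    and ex: "\<And>x. x \<in> A \<Longrightarrow> x \<in> carrier M \<and> (\<exists>u \<in> carrier R - I. u \<odot>\<^bsub>M\<^esub> x \<in> N)"
  shows "\<exists>u \<in> carrier R - I. \<forall>x \<in> A. u \<odot>\<^bsub>M\<^esub> x \<in> N"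
  using fin ex
proof (induction A)
  case empty
  then show ?case using one_notin by blast
next
  case (insert y A)
  interpret M: module R M by (rule M)
  from insert obtain u v where uv: "u \<in> carrier R" "u \<notin> I" "\<forall>x\<in>A. u \<odot>\<^bsub>M\<^esub> x \<in> N"
     "v \<in> carrier R" "v \<notin> I" "v \<odot>\<^bsub>M\<^esub> y \<in> N" by (metis DiffE insertCI)
  have "(u \<otimes> v) \<odot>\<^bsub>M\<^esub> x \<in> N" if x: "x \<in> insert y A" for x
  proof (cases "x = y")
    case True
    with uv insert.prems[of y] M.submoduleE(4)[OF N] show ?thesis by (simp add: M.smult_assoc1)
  next
    case False
    have "(u \<otimes> v) \<odot>\<^bsub>M\<^esub> x = v \<odot>\<^bsub>M\<^esub> (u \<odot>\<^bsub>M\<^esub> x)"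
      using uv insert.prems[OF x] by (subst m_comm) (auto simp: M.smult_assoc1)
    with uv M.submoduleE(4)[OF N] False x show ?thesis by auto
  qed
  moreover have "u \<otimes> v \<in> carrier R - I" using uv mult_notin by auto
  ultimately show ?case by blast
qed

lemma (in module) saturated_carrier: "saturated R M P (carrier M)"
  by (simp add: saturated_def carrier_is_submodule)

lemma (in module) saturated_saturation:
  assumes P: "primeideal P R" and N: "submodule N R M"
  shows "saturated R M P (saturation R M P N)"
proof -
  interpret P: primeideal P R by (rule P)
  note NE = submoduleE[OF N]
  have "submodule (saturation R M P N) R M"
  proof (rule submoduleI)
    show "\<zero>\<^bsub>M\<^esub> \<in> saturation R M P N"
      using submodule_zero_closed[OF N] P.one_notin by (auto simp: saturation_def intro!: bexI[of _ \<one>])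
    show "a \<oplus>\<^bsub>M\<^esub> b \<in> saturation R M P N"
      if "a \<in> saturation R M P N" "b \<in> saturation R M P N" for a b
    proof -
      from that have ab: "a \<in> carrier M" "b \<in> carrier M" by (auto simp: saturation_def)
      \<comment> \<open>The multipliers of \<open>a\<close> and \<open>b\<close> may differ; a sum
        needs one that serves both.\<close>
      have "\<exists>u \<in> carrier R - P. \<forall>x \<in> {a, b}. u \<odot>\<^bsub>M\<^esub> x \<in> N"
        by (rule P.finite_common_multiplier[OF module_axioms N])
          (use that in \<open>auto simp: saturation_def\<close>)
      then obtain u where "u \<in> carrier R - P" "u \<odot>\<^bsub>M\<^esub> a \<in> N" "u \<odot>\<^bsub>M\<^esub> b \<in> N" by auto
      then show ?thesis using ab NE(5) by (auto simp: saturation_def smult_r_distr intro!: bexI[of _ u])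
    qed
    show "r \<odot>\<^bsub>M\<^esub> x \<in> saturation R M P N" if r: "r \<in> carrier R" and x: "x \<in> saturation R M P N" for r x
    proof -
      from x obtain u where u: "x \<in> carrier M" "u \<in> carrier R - P" "u \<odot>\<^bsub>M\<^esub> x \<in> N"
        by (auto simp: saturation_def)
      then have "u \<odot>\<^bsub>M\<^esub> (r \<odot>\<^bsub>M\<^esub> x) = r \<odot>\<^bsub>M\<^esub> (u \<odot>\<^bsub>M\<^esub> x)" using r
        by (metis DiffE R.m_comm smult_assoc1)
      then have "u \<odot>\<^bsub>M\<^esub> (r \<odot>\<^bsub>M\<^esub> x) \<in> N" using u r NE(4) by simp
      then show ?thesis using u r by (auto simp: saturation_def)
    qed
    show "\<ominus>\<^bsub>M\<^esub> a \<in> saturation R M P N" if a: "a \<in> saturation R M P N" for a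
    proof -
      from a obtain u where u: "a \<in> carrier M" "u \<in> carrier R - P" "u \<odot>\<^bsub>M\<^esub> a \<in> N"
        by (auto simp: saturation_def)
      then have "u \<odot>\<^bsub>M\<^esub> (\<ominus>\<^bsub>M\<^esub> a) \<in> N" using NE(3) by (simp add: smult_r_minus)
      with u show ?thesis by (auto simp: saturation_def)
    qed
  qed (auto simp: saturation_def)
  moreover have "x \<in> saturation R M P N"
    if "u \<in> carrier R - P" "x \<in> carrier M" "u \<odot>\<^bsub>M\<^esub> x \<in> saturation R M P N" for u x
  proof -
    from that obtain v where v: "v \<in> carrier R - P" "v \<odot>\<^bsub>M\<^esub> (u \<odot>\<^bsub>M\<^esub> x) \<in> N"
      by (auto simp: saturation_def)
    then have "(v \<otimes> u) \<odot>\<^bsub>M\<^esub> x \<in> N" "v \<otimes> u \<in> carrier R - P"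
      using that P.mult_notin by (auto simp: smult_assoc1)
    then show ?thesis using that by (auto simp: saturation_def)
  qed
  ultimately show ?thesis by (simp add: saturated_def)
qed

lemma (in module) subset_saturation:
  assumes P: "primeideal P R" and N: "submodule N R M"
  shows "N \<subseteq> saturation R M P N"
  using submoduleE(1,4)[OF N] primeideal.one_notin[OF P]
  by (auto simp: saturation_def intro!: bexI[of _ \<one>])

lemma (in module) saturation_minimal:
  assumes "saturated R M P N" and "L \<subseteq> N"
  shows "saturation R M P L \<subseteq> N"
  using assms by (auto simp: saturation_def saturated_def)

lemma (in module) smult_vimage_submodule:
  assumes N: "submodule N R M" and u: "u \<in> carrier R"
  shows "submodule {x \<in> carrier M. u \<odot>\<^bsub>M\<^esub> x \<in> N} R M"
proof (rule submoduleI)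
  note NE = submoduleE[OF N]
  show "r \<odot>\<^bsub>M\<^esub> x \<in> {x \<in> carrier M. u \<odot>\<^bsub>M\<^esub> x \<in> N}"
    if r: "r \<in> carrier R" and x: "x \<in> {x \<in> carrier M. u \<odot>\<^bsub>M\<^esub> x \<in> N}" for r x
  proof -
    have "u \<odot>\<^bsub>M\<^esub> (r \<odot>\<^bsub>M\<^esub> x) = r \<odot>\<^bsub>M\<^esub> (u \<odot>\<^bsub>M\<^esub> x)" using r u x
      by (metis (no_types, lifting) R.m_comm mem_Collect_eq smult_assoc1)
    then show ?thesis using r x NE(4) by simp
  qed
qed (use u submoduleE[OF N] submodule_zero_closed[OF N] in \<open>auto simp: smult_r_distr smult_r_minus\<close>)

text \<open>When \<open>N\<^sub>P\<close> is all of \<open>M\<^sub>P\<close>, a common multiplier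
  exists for the finitely many generators. The elements that it carries into \<open>N\<close> form a
  submodule, which therefore contains the whole span.\<close>

lemma (in module) finitely_generated_common_multiplier:
  assumes P: "primeideal P R" and fg: "finitely_generated_module R M"
    and N: "submodule N R M" and M: "saturation R M P N = carrier M"
  obtains u where "u \<in> carrier R" and "u \<notin> P" and "\<And>x. x \<in> carrier M \<Longrightarrow> u \<odot>\<^bsub>M\<^esub> x \<in> N"
proof -
  from fg obtain A where A: "A \<subseteq> carrier M" "finite A" "submodule_span R M A = carrier M"
    by (auto simp: finitely_generated_module_def)
  have "\<exists>u \<in> carrier R - P. \<forall>x \<in> A. u \<odot>\<^bsub>M\<^esub> x \<in> N"
    by (rule primeideal.finite_common_multiplier[OF P module_axioms N A(2)])
      (use A(1) M in \<open>auto simp: saturation_def\<close>)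
  then obtain u where u: "u \<in> carrier R" "u \<notin> P" "\<forall>x \<in> A. u \<odot>\<^bsub>M\<^esub> x \<in> N" by auto
  then have "carrier M \<subseteq> {x \<in> carrier M. u \<odot>\<^bsub>M\<^esub> x \<in> N}"
    using A submodule_span_minimal[OF smult_vimage_submodule[OF N u(1)], of A] by auto
  with u show thesis using that by blast
qed

text \<open>Since Q contains the annihilator, \<open>M\<^sub>Q\<close> is nonzero. An associated
  prime P of M modulo the kernel T of the map to \<open>M\<^sub>Q\<close> is found first, and it is
  then realized as the annihilator of an element of M itself.\<close>

lemma (in module) associated_prime_below:
  assumes noeth: "noetherian_ring R" and fg: "finitely_generated_module R M"
    and Q: "primeideal Q R" and ann: "annihilator R M \<subseteq> Q"
  obtains P where "P \<in> associated_primes R M" and "P \<subseteq> Q"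
proof -
  interpret noetherian_ring R by (rule noeth)
  define T where "T = saturation R M Q {\<zero>\<^bsub>M\<^esub>}"
  have T: "saturated R M Q T" unfolding T_def by (rule saturated_saturation[OF Q zero_submodule])
  \<comment> \<open>Otherwise finite generation would give one element outside \<open>Q\<close> that
    annihilates M.\<close>
  have "T \<noteq> carrier M"
  proof
    assume "T = carrier M"
    then obtain u where "u \<in> carrier R" "u \<notin> Q" "\<And>x. x \<in> carrier M \<Longrightarrow> u \<odot>\<^bsub>M\<^esub> x \<in> {\<zero>\<^bsub>M\<^esub>}"
      using finitely_generated_common_multiplier[OF Q fg zero_submodule] by (auto simp: T_def)
    with ann show False by (auto simp: annihilator_def)
  qed
  then obtain m where m: "m \<in> carrier M" "m \<notin> T" by (auto simp: T_def saturation_def)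
  obtain r where r: "r \<in> carrier R" "r \<odot>\<^bsub>M\<^esub> m \<notin> T" and pr: "primeideal (colon R M T (r \<odot>\<^bsub>M\<^esub> m)) R"
    using prime_colon[OF noeth saturatedD(1)[OF T] m] .
  define z where "z = r \<odot>\<^bsub>M\<^esub> m"
  define P where "P = colon R M T z"
  have z: "z \<in> carrier M" "z \<notin> T" using r m by (auto simp: z_def)
  have P: "primeideal P R" using pr by (simp add: P_def z_def)
  then have "ideal P R" by (rule primeideal.axioms)
  \<comment> \<open>So far P only carries \<open>z\<close> into \<open>T\<close>. As P is finitely
    generated, a single \<open>u\<close> outside \<open>Q\<close> kills all of P z, and this makes P
    the annihilator of \<open>u \<odot> z\<close>.\<close>
  then obtain A where A: "A \<subseteq> carrier R" "finite A" "P = Idl A" using finetely_gen by blast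
  then have AP: "A \<subseteq> P" using genideal_self by simp
  have "\<exists>u \<in> carrier R - Q. \<forall>x \<in> (\<lambda>a. a \<odot>\<^bsub>M\<^esub> z) ` A. u \<odot>\<^bsub>M\<^esub> x \<in> {\<zero>\<^bsub>M\<^esub>}"
    by (rule primeideal.finite_common_multiplier[OF Q module_axioms zero_submodule])
      (use A AP z in \<open>auto simp: P_def colon_def T_def saturation_def\<close>)
  then obtain u where u: "u \<in> carrier R" "u \<notin> Q" "\<forall>a \<in> A. u \<odot>\<^bsub>M\<^esub> (a \<odot>\<^bsub>M\<^esub> z) = \<zero>\<^bsub>M\<^esub>" by auto
  have swap: "c \<odot>\<^bsub>M\<^esub> (u \<odot>\<^bsub>M\<^esub> z) = u \<odot>\<^bsub>M\<^esub> (c \<odot>\<^bsub>M\<^esub> z)" if "c \<in> carrier R" for c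
    using that u z by (metis R.m_comm smult_assoc1)
  have uz: "u \<odot>\<^bsub>M\<^esub> z \<in> carrier M" using u z by simp
  have "P = elem_annihilator R M (u \<odot>\<^bsub>M\<^esub> z)"
  proof
    show "P \<subseteq> elem_annihilator R M (u \<odot>\<^bsub>M\<^esub> z)"
      unfolding A(3) by (rule genideal_minimal[OF ideal_elem_annihilator[OF uz]])
        (use A u swap in \<open>auto simp: elem_annihilator_def\<close>)
    show "elem_annihilator R M (u \<odot>\<^bsub>M\<^esub> z) \<subseteq> P"
      using u z swap by (auto simp: elem_annihilator_def P_def colon_def T_def saturation_def)
  qed
  with P uz have "P \<in> associated_primes R M" by (auto simp: associated_primes_def)
  \<comment> \<open>An element of \<open>P\<close> outside \<open>Q\<close> would carry
    \<open>z\<close> into the saturated \<open>T\<close> and so force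
    \<open>z \<in> T\<close>.\<close>
  moreover have "P \<subseteq> Q" using z saturatedD(2)[OF T, of _ z] by (auto simp: P_def colon_def)
  ultimately show thesis by (rule that)
qed

section \<open>Finite length of \<open>M\<^sub>P\<close> at a minimal prime\<close>

text \<open>For saturated \<open>N\<close> this expresses that \<open>N\<^sub>P\<close> has finite
  length. Instead of bounding the lengths of chains, it asks for a bounded, strictly increasing
  height function \<open>d\<close>; such functions can be glued along an inclusion with simple
  quotient.\<close>

definition bounded_chains ::
  "('a, 'c) ring_scheme \<Rightarrow> ('a, 'b, 'd) module_scheme \<Rightarrow> 'a set \<Rightarrow> 'b set \<Rightarrow> bool"
  where "bounded_chains R M P N \<longleftrightarrow> (\<exists>(d :: 'b set \<Rightarrow> nat) n.
    (\<forall>C. saturated R M P C \<and> C \<subseteq> N \<longrightarrow> d C \<le> n) \<and>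
    (\<forall>C D. saturated R M P C \<and> saturated R M P D \<and> C \<subset> D \<and> D \<subseteq> N \<longrightarrow> d C < d D))"

lemma (in module) saturation_zero_subset:
  "saturated R M P N \<Longrightarrow> saturation R M P {\<zero>\<^bsub>M\<^esub>} \<subseteq> N"
  using saturation_minimal submodule_zero_closed[OF saturatedD(1)] by blast

text \<open>Every saturated submodule contains the saturation of zero, so there are no strict
  inclusions to measure and a constant height works.\<close>

lemma (in module) bounded_chains_saturation_zero:
  "bounded_chains R M P (saturation R M P {\<zero>\<^bsub>M\<^esub>})"
  unfolding bounded_chains_def using saturation_zero_subset[of P]
  by (intro exI[of _ "\<lambda>_. 0"] exI[of _ 0]) blast

lemma (in module) saturated_Int:
  assumes "saturated R M P N" and "saturated R M P L"
  shows "saturated R M P (N \<inter> L)"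
proof -
  note N = saturatedD[OF assms(1)] and L = saturatedD[OF assms(2)]
  have "submodule (N \<inter> L) R M"
    by (rule submoduleI)
      (use submoduleE[OF N(1)] submoduleE[OF L(1)] submodule_zero_closed[OF N(1)]
        submodule_zero_closed[OF L(1)] in auto)
  then show ?thesis using N(2) L(2) by (auto simp: saturated_def)
qed

text \<open>The second assumption says that \<open>N'\<^sub>P / N\<^sub>P\<close> is a simple module.\<close>

lemma (in module) bounded_chains_step:
  assumes N: "saturated R M P N" and
    simple: "\<And>w z. \<lbrakk>w \<in> N'; w \<notin> N; z \<in> N'\<rbrakk> \<Longrightarrow>
      \<exists>s \<in> carrier R - P. \<exists>t \<in> carrier R. s \<odot>\<^bsub>M\<^esub> z \<oplus>\<^bsub>M\<^esub> t \<odot>\<^bsub>M\<^esub> w \<in> N"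
    and bd: "bounded_chains R M P N"
  shows "bounded_chains R M P N'"
proof -
  from bd obtain d :: "'c set \<Rightarrow> nat" and n where
    dn: "\<And>C. saturated R M P C \<Longrightarrow> C \<subseteq> N \<Longrightarrow> d C \<le> n" and
    mono: "\<And>C D. \<lbrakk>saturated R M P C; saturated R M P D; C \<subset> D; D \<subseteq> N\<rbrakk> \<Longrightarrow> d C < d D"
    unfolding bounded_chains_def by metis
  \<comment> \<open>The first summand is the height of the trace on \<open>N\<close>; the second
    records whether \<open>C\<close> has a nonzero image in the simple quotient of \<open>N'\<close>
    by \<open>N\<close>.\<close>
  define e where "e C = d (C \<inter> N) + (if C \<subseteq> N then 0 else 1)" for C
  have "e C \<le> n + 1" if "saturated R M P C" for C
    using dn[OF saturated_Int[OF that N]] by (auto simp: e_def)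
  moreover have "e C < e D"
    if C: "saturated R M P C" and D: "saturated R M P D" and CD: "C \<subset> D" "D \<subseteq> N'" for C D
  proof (cases "C \<inter> N = D \<inter> N")
    case False
    then have "d (C \<inter> N) < d (D \<inter> N)" using CD mono[OF saturated_Int[OF C N] saturated_Int[OF D N]] by blast
    then show ?thesis using CD by (auto simp: e_def)
  next
    case True
    \<comment> \<open>Once \<open>C\<close> lies in \<open>N\<close>, the strictly larger
      \<open>D\<close> with the same trace cannot, so the second summand grows. If \<open>C\<close>
      had an element \<open>w\<close> outside \<open>N\<close>, simplicity would express each
      element of \<open>D\<close>, up to a multiplier outside \<open>P\<close>, by \<open>w\<close>
      and an element of the common trace, so that \<open>D \<subseteq> C\<close>.\<close>
    have "C \<subseteq> N"
    proof (rule ccontr)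
      assume "\<not> C \<subseteq> N"
      then obtain w where w: "w \<in> C" "w \<notin> N" by auto
      note CE = submoduleE[OF saturatedD(1)[OF C]] and DE = submoduleE[OF saturatedD(1)[OF D]]
      have "z \<in> C" if z: "z \<in> D" for z
      proof -
        obtain s t where st: "s \<in> carrier R" "s \<notin> P" "t \<in> carrier R" "s \<odot>\<^bsub>M\<^esub> z \<oplus>\<^bsub>M\<^esub> t \<odot>\<^bsub>M\<^esub> w \<in> N"
          using simple[of w z] w z CD by auto
        have car: "z \<in> carrier M" "w \<in> carrier M" using z w CE(1) DE(1) by auto
        have "s \<odot>\<^bsub>M\<^esub> z \<oplus>\<^bsub>M\<^esub> t \<odot>\<^bsub>M\<^esub> w \<in> D \<inter> N" using st z w CD DE by auto
        then have "s \<odot>\<^bsub>M\<^esub> z \<oplus>\<^bsub>M\<^esub> t \<odot>\<^bsub>M\<^esub> w \<in> C" using True by auto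
        then have "(s \<odot>\<^bsub>M\<^esub> z \<oplus>\<^bsub>M\<^esub> t \<odot>\<^bsub>M\<^esub> w) \<oplus>\<^bsub>M\<^esub> \<ominus>\<^bsub>M\<^esub> (t \<odot>\<^bsub>M\<^esub> w) \<in> C" using CE st w by blast
        then have "s \<odot>\<^bsub>M\<^esub> z \<in> C" using car st by (simp add: M.a_assoc M.r_neg)
        then show ?thesis using saturatedD(2)[OF C] st car by blast
      qed
      with CD show False by auto
    qed
    then show ?thesis using CD True by (auto simp: e_def)
  qed
  ultimately show ?thesis unfolding bounded_chains_def by (intro exI[of _ e] exI[of _ "n + 1"]) auto
qed

text \<open>Take for \<open>N'\<close> the saturation of N + Rz. Because (N : z) = P, the quotient
  of \<open>N'\<close> by \<open>N\<close> becomes the residue field of P after localization, which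
  is simple, so \<open>bounded_chains_step\<close> applies.\<close>

lemma (in module) bounded_chains_extend:
  assumes P: "primeideal P R" and N: "saturated R M P N" and z: "z \<in> carrier M"
    and colon: "colon R M N z = P" and bd: "bounded_chains R M P N"
  obtains N' where "saturated R M P N'" and "N \<subseteq> N'" and "z \<in> N'" and "bounded_chains R M P N'"
proof -
  define L where "L = {x \<oplus>\<^bsub>M\<^esub> y | x y. x \<in> N \<and> y \<in> (\<lambda>r. r \<odot>\<^bsub>M\<^esub> z) ` carrier R}"
  note Nsub = saturatedD(1)[OF N] and NE = submoduleE[OF saturatedD(1)[OF N]]
  have L: "submodule L R M" unfolding L_def by (rule sum_submodule[OF Nsub cyclic_submodule[OF z]])
  define N' where "N' = saturation R M P L"
  have LN': "L \<subseteq> N'" unfolding N'_def by (rule subset_saturation[OF P L])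
  have "x \<in> L" if "x \<in> N" for x
  proof -
    have "x \<oplus>\<^bsub>M\<^esub> \<zero> \<odot>\<^bsub>M\<^esub> z \<in> L" unfolding L_def using that by blast
    then show ?thesis using that z NE(1) by auto
  qed
  then have 1: "N \<subseteq> N'" using LN' by blast
  have "\<zero>\<^bsub>M\<^esub> \<oplus>\<^bsub>M\<^esub> \<one> \<odot>\<^bsub>M\<^esub> z \<in> L" unfolding L_def using submodule_zero_closed[OF Nsub] by blast
  then have 2: "z \<in> N'" using LN' z by auto
  have 3: "saturated R M P N'" unfolding N'_def by (rule saturated_saturation[OF P L])
  have "bounded_chains R M P N'"
  proof (rule bounded_chains_step[OF N _ bd])
    fix w y assume w: "w \<in> N'" "w \<notin> N" and y: "y \<in> N'"
    have ex: "\<exists>u n r. x \<in> carrier M \<and> u \<in> carrier R \<and> u \<notin> P \<and> n \<in> N \<and> r \<in> carrier R \<and>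
        u \<odot>\<^bsub>M\<^esub> x = n \<oplus>\<^bsub>M\<^esub> r \<odot>\<^bsub>M\<^esub> z" if "x \<in> N'" for x
      using that by (auto simp: N'_def saturation_def L_def)
    obtain u n r where u: "y \<in> carrier M" "u \<in> carrier R" "u \<notin> P" "n \<in> N" "r \<in> carrier R"
      "u \<odot>\<^bsub>M\<^esub> y = n \<oplus>\<^bsub>M\<^esub> r \<odot>\<^bsub>M\<^esub> z" using ex[OF y] by blast
    obtain v n' r' where v: "w \<in> carrier M" "v \<in> carrier R" "v \<notin> P" "n' \<in> N" "r' \<in> carrier R"
      "v \<odot>\<^bsub>M\<^esub> w = n' \<oplus>\<^bsub>M\<^esub> r' \<odot>\<^bsub>M\<^esub> z" using ex[OF w(1)] by blast
    have n: "n \<in> carrier M" "n' \<in> carrier M" using u v NE(1) by auto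
    \<comment> \<open>The coefficient of \<open>z\<close> in \<open>v \<odot> w\<close> must be a
      unit at P: with \<open>r' \<in> P\<close> the element \<open>w\<close> would already lie in
      the saturated \<open>N\<close>.\<close>
    have "r' \<notin> P"
    proof
      assume "r' \<in> P"
      then have "r' \<odot>\<^bsub>M\<^esub> z \<in> N" using colon by (auto simp: colon_def)
      then have "v \<odot>\<^bsub>M\<^esub> w \<in> N" using v NE(5) by simp
      then show False using saturatedD(2)[OF N] v w by blast
    qed
    then have s: "r' \<otimes> u \<in> carrier R - P" using primeideal.mult_notin[OF P] u v by blast
    have c: "r \<odot>\<^bsub>M\<^esub> (r' \<odot>\<^bsub>M\<^esub> z) = r' \<odot>\<^bsub>M\<^esub> (r \<odot>\<^bsub>M\<^esub> z)"
      using u v z by (metis R.m_comm smult_assoc1)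
    \<comment> \<open>Cross multiplication eliminates \<open>z\<close>: \<open>r'\<close> times the
      equation for \<open>y\<close> minus \<open>r\<close> times the equation for
      \<open>w\<close>.\<close>
    have "(r' \<otimes> u) \<odot>\<^bsub>M\<^esub> y \<oplus>\<^bsub>M\<^esub> (\<ominus> (r \<otimes> v)) \<odot>\<^bsub>M\<^esub> w
      = (r' \<odot>\<^bsub>M\<^esub> n \<oplus>\<^bsub>M\<^esub> r' \<odot>\<^bsub>M\<^esub> (r \<odot>\<^bsub>M\<^esub> z)) \<oplus>\<^bsub>M\<^esub>
        (\<ominus>\<^bsub>M\<^esub> (r \<odot>\<^bsub>M\<^esub> n') \<oplus>\<^bsub>M\<^esub> \<ominus>\<^bsub>M\<^esub> (r' \<odot>\<^bsub>M\<^esub> (r \<odot>\<^bsub>M\<^esub> z)))"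
      using u v n z c by (simp add: smult_assoc1 smult_l_minus smult_r_distr M.minus_add)
    also have "\<dots> = r' \<odot>\<^bsub>M\<^esub> n \<oplus>\<^bsub>M\<^esub> \<ominus>\<^bsub>M\<^esub> (r \<odot>\<^bsub>M\<^esub> n')"
      using u v n z by (simp add: M.a_ac M.r_neg M.r_neg1 M.r_neg2)
    also have "\<dots> \<in> N" using u v by (intro NE(3,4,5))
    finally show "\<exists>s \<in> carrier R - P. \<exists>t \<in> carrier R. s \<odot>\<^bsub>M\<^esub> y \<oplus>\<^bsub>M\<^esub> t \<odot>\<^bsub>M\<^esub> w \<in> N"
      using s u v by blast
  qed
  with 1 2 3 show thesis using that by blast
qed

text \<open>The classical fact that \<open>M\<^sub>P\<close> has finite length when P is minimal
  over the annihilator. Generators are absorbed one at a time: as long as \<open>g\<close> is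
  missing from a saturated \<open>L\<close>, some multiple of \<open>g\<close> has colon ideal
  exactly \<open>P\<close>, by minimality, and can be adjoined by
  \<open>bounded_chains_extend\<close>. The ascending chain condition on ideals ends the
  process.\<close>

lemma (in module) bounded_chains_carrier:
  assumes noeth: "noetherian_ring R" and fg: "finitely_generated_module R M"
    and P: "primeideal P R"
    and min: "\<And>Q. \<lbrakk>primeideal Q R; annihilator R M \<subseteq> Q; Q \<subseteq> P\<rbrakk> \<Longrightarrow> Q = P"
  shows "bounded_chains R M P (carrier M)"
proof -
  interpret noetherian_ring R by (rule noeth)
  from fg obtain A where A: "A \<subseteq> carrier M" "finite A" "submodule_span R M A = carrier M"
    by (auto simp: finitely_generated_module_def)
  have "\<exists>N. saturated R M P N \<and> A \<subseteq> N \<and> bounded_chains R M P N"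
    using A(2,1)
  proof (induction A)
    case empty
    then show ?case using bounded_chains_saturation_zero saturated_saturation[OF P zero_submodule] by blast
  next
    case (insert g A)
    then obtain N where N: "saturated R M P N" "A \<subseteq> N" "bounded_chains R M P N" by auto
    have g: "g \<in> carrier M" using insert by auto
    \<comment> \<open>Maximizing the ideals (L : g), and not the submodules \<open>L\<close>
      themselves, lets the Noetherian property of R be used directly.\<close>
    define F where "F = {colon R M L g | L. saturated R M P L \<and> N \<subseteq> L \<and> bounded_chains R M P L}"
    have "F \<noteq> {}" using N by (auto simp: F_def)
    moreover have "ideal I R" if "I \<in> F" for I
      using that ideal_colon[OF saturatedD(1) g] by (auto simp: F_def)
    ultimately obtain I where I: "I \<in> F" and max: "\<And>J. J \<in> F \<Longrightarrow> I \<subseteq> J \<Longrightarrow> J = I"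
      using exists_maximal_ideal_in by metis
    then obtain L where L: "I = colon R M L g" "saturated R M P L" "N \<subseteq> L" "bounded_chains R M P L"
      by (auto simp: F_def)
    have "g \<in> L"
    proof (rule ccontr)
      assume gL: "g \<notin> L"
      obtain r where r: "r \<in> carrier R" "r \<odot>\<^bsub>M\<^esub> g \<notin> L" "primeideal (colon R M L (r \<odot>\<^bsub>M\<^esub> g)) R"
        using prime_colon[OF noeth saturatedD(1)[OF L(2)] g gL] .
      have rg: "r \<odot>\<^bsub>M\<^esub> g \<in> carrier M" using r g by simp
      have "colon R M L (r \<odot>\<^bsub>M\<^esub> g) = P"
      proof (rule min[OF r(3)])
        show "annihilator R M \<subseteq> colon R M L (r \<odot>\<^bsub>M\<^esub> g)"
          using rg submodule_zero_closed[OF saturatedD(1)[OF L(2)]]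
          by (auto simp: annihilator_def colon_def)
        \<comment> \<open>Since \<open>L\<close> is saturated and \<open>r \<odot> g\<close> is not
          in it, no scalar outside \<open>P\<close> can carry \<open>r \<odot> g\<close> into
          \<open>L\<close>.\<close>
        show "colon R M L (r \<odot>\<^bsub>M\<^esub> g) \<subseteq> P"
          using saturatedD(2)[OF L(2) _ _ rg] r(2) by (auto simp: colon_def)
      qed
      then obtain L' where L': "saturated R M P L'" "L \<subseteq> L'" "r \<odot>\<^bsub>M\<^esub> g \<in> L'" "bounded_chains R M P L'"
        using bounded_chains_extend[OF P L(2) rg _ L(4)] by blast
      then have "colon R M L' g \<in> F" using L by (auto simp: F_def)
      moreover have "I \<subseteq> colon R M L' g" using L L' by (auto simp: colon_def)
      ultimately have "colon R M L' g = I" by (rule max)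
      \<comment> \<open>The scalar \<open>r\<close> distinguishes the two ideals: it carries
        \<open>g\<close> into \<open>L'\<close> but not into \<open>L\<close>.\<close>
      then show False using L r L' by (auto simp: colon_def)
    qed
    then show ?case using L N by blast
  qed
  then obtain N where N: "saturated R M P N" "A \<subseteq> N" "bounded_chains R M P N" by blast
  then have "N = carrier M" using submodule_span_minimal[OF saturatedD(1)[OF N(1)] N(2)] A(3)
    submoduleE(1)[OF saturatedD(1)[OF N(1)]] by auto
  with N show ?thesis by simp
qed

section \<open>Localization at a prime\<close>

text \<open>With this, the facts about fractions of a module also apply to the elements of the
  localized ring, which are fractions of the regular module.\<close>

lemma (in cring) module_regular_module: "module R (regular_module R)"
proof (rule moduleI)
  show "abelian_group (regular_module R)"
    by (rule abelian_groupI)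
      (auto simp: regular_module_def a_ac intro: bexI[of _ "\<ominus> _"] l_neg)
qed (auto simp: regular_module_def l_distr r_distr m_assoc is_cring)

locale module_prime = module R M + P: primeideal P R for P and R (structure) and M (structure)
begin

abbreviation frac :: "'c \<Rightarrow> 'a \<Rightarrow> ('c \<times> 'a) set"
  where "frac \<equiv> fraction R M (carrier R - P)"

abbreviation rfrac :: "'a \<Rightarrow> 'a \<Rightarrow> ('a \<times> 'a) set"
  where "rfrac \<equiv> fraction R (regular_module R) (carrier R - P)"

abbreviation RP where "RP \<equiv> localized_ring R P"
abbreviation MP where "MP \<equiv> localized_module R M P"

lemmas smult_assoc_sym = smult_assoc1[symmetric]

lemma frac_mem_iff: "(y, t) \<in> frac x s \<longleftrightarrow> y \<in> carrier M \<and> t \<in> carrier R \<and> t \<notin> P \<and>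
    (\<exists>u \<in> carrier R - P. u \<odot>\<^bsub>M\<^esub> (t \<odot>\<^bsub>M\<^esub> x) = u \<odot>\<^bsub>M\<^esub> (s \<odot>\<^bsub>M\<^esub> y))"
  by (auto simp: fraction_def)

lemma frac_self: "\<lbrakk>x \<in> carrier M; s \<in> carrier R; s \<notin> P\<rbrakk> \<Longrightarrow> (x, s) \<in> frac x s"
  using P.one_notin by (auto simp: frac_mem_iff)

lemma frac_sym: "\<lbrakk>(y, t) \<in> frac x s; x \<in> carrier M; s \<in> carrier R; s \<notin> P\<rbrakk> \<Longrightarrow> (x, s) \<in> frac y t"
  by (auto simp: frac_mem_iff) (metis DiffI)

lemma frac_trans:
  assumes "(y, t) \<in> frac x s" and "(z, w) \<in> frac y t" and x: "x \<in> carrier M" and s: "s \<in> carrier R"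
  shows "(z, w) \<in> frac x s"
proof -
  from assms obtain u v where
    t: "y \<in> carrier M" "t \<in> carrier R" "t \<notin> P" and w: "z \<in> carrier M" "w \<in> carrier R" "w \<notin> P" and
    u: "u \<in> carrier R" "u \<notin> P" "u \<odot>\<^bsub>M\<^esub> (t \<odot>\<^bsub>M\<^esub> x) = u \<odot>\<^bsub>M\<^esub> (s \<odot>\<^bsub>M\<^esub> y)" and
    v: "v \<in> carrier R" "v \<notin> P" "v \<odot>\<^bsub>M\<^esub> (w \<odot>\<^bsub>M\<^esub> y) = v \<odot>\<^bsub>M\<^esub> (t \<odot>\<^bsub>M\<^esub> z)"
    by (auto simp: frac_mem_iff)
  \<comment> \<open>Besides the two witnesses \<open>u\<close> and \<open>v\<close>, the multiplier
    must contain the middle denominator \<open>t\<close>, through which the two fractions are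
    compared.\<close>
  have "(u \<otimes> v \<otimes> t) \<odot>\<^bsub>M\<^esub> (w \<odot>\<^bsub>M\<^esub> x) = (v \<otimes> w) \<odot>\<^bsub>M\<^esub> (u \<odot>\<^bsub>M\<^esub> (t \<odot>\<^bsub>M\<^esub> x))"
    using u(1) v(1) t w x s by (simp add: smult_assoc_sym R.m_ac)
  also have "\<dots> = (u \<otimes> s) \<odot>\<^bsub>M\<^esub> (v \<odot>\<^bsub>M\<^esub> (w \<odot>\<^bsub>M\<^esub> y))"
    unfolding u(3) using u(1) v(1) t w x s by (simp add: smult_assoc_sym R.m_ac)
  also have "\<dots> = (u \<otimes> v \<otimes> t) \<odot>\<^bsub>M\<^esub> (s \<odot>\<^bsub>M\<^esub> z)"
    unfolding v(3) using u(1) v(1) t w x s by (simp add: smult_assoc_sym R.m_ac)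
  finally have "(u \<otimes> v \<otimes> t) \<odot>\<^bsub>M\<^esub> (w \<odot>\<^bsub>M\<^esub> x) = (u \<otimes> v \<otimes> t) \<odot>\<^bsub>M\<^esub> (s \<odot>\<^bsub>M\<^esub> z)" .
  moreover have "u \<otimes> v \<otimes> t \<in> carrier R - P" using P.mult_notin u v t by simp
  ultimately show ?thesis using w by (auto simp: frac_mem_iff)
qed

lemma frac_eqI:
  assumes "(y, t) \<in> frac x s" and "x \<in> carrier M" and "s \<in> carrier R" and "s \<notin> P"
  shows "frac y t = frac x s"
proof -
  from assms(1) have "y \<in> carrier M" "t \<in> carrier R" by (auto simp: frac_mem_iff)
  then have "p \<in> frac y t \<longleftrightarrow> p \<in> frac x s" for p
    using assms frac_trans frac_sym by (cases p) blast
  then show ?thesis by blast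
qed

lemma frac_eq_iff:
  assumes "x \<in> carrier M" "y \<in> carrier M" "s \<in> carrier R" "s \<notin> P" "t \<in> carrier R" "t \<notin> P"
  shows "frac x s = frac y t \<longleftrightarrow>
    (\<exists>u \<in> carrier R - P. u \<odot>\<^bsub>M\<^esub> (t \<odot>\<^bsub>M\<^esub> x) = u \<odot>\<^bsub>M\<^esub> (s \<odot>\<^bsub>M\<^esub> y))"
proof -
  have "frac x s = frac y t \<longleftrightarrow> (y, t) \<in> frac x s"
    using frac_self[of y t] frac_eqI[of y t x s] assms by auto
  then show ?thesis using assms by (simp add: frac_mem_iff)
qed

lemma frac_cancel:
  assumes "x \<in> carrier M" "s \<in> carrier R" "s \<notin> P" "t \<in> carrier R" "t \<notin> P"
  shows "frac (t \<odot>\<^bsub>M\<^esub> x) (t \<otimes> s) = frac x s"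
proof -
  have "\<one> \<odot>\<^bsub>M\<^esub> (s \<odot>\<^bsub>M\<^esub> (t \<odot>\<^bsub>M\<^esub> x)) = \<one> \<odot>\<^bsub>M\<^esub> ((t \<otimes> s) \<odot>\<^bsub>M\<^esub> x)"
    using assms by (simp add: smult_assoc_sym R.m_comm)
  then show ?thesis using assms P.one_notin P.mult_notin
    by (subst frac_eq_iff) (auto intro!: bexI[of _ \<one>])
qed

text \<open>The sum of classes is a union over all pairs of representatives. It collapses to one
  class because any two pairs give equal fractions, with the product of the two witnesses as the
  multiplier.\<close>

lemma fraction_add_frac:
  assumes "x \<in> carrier M" "y \<in> carrier M" "s \<in> carrier R" "s \<notin> P" "t \<in> carrier R" "t \<notin> P"
  shows "fraction_add R M (carrier R - P) (frac x s) (frac y t)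
    = frac (t \<odot>\<^bsub>M\<^esub> x \<oplus>\<^bsub>M\<^esub> s \<odot>\<^bsub>M\<^esub> y) (s \<otimes> t)"
proof -
  have eq: "frac (t' \<odot>\<^bsub>M\<^esub> x' \<oplus>\<^bsub>M\<^esub> s' \<odot>\<^bsub>M\<^esub> y') (s' \<otimes> t') = frac (t \<odot>\<^bsub>M\<^esub> x \<oplus>\<^bsub>M\<^esub> s \<odot>\<^bsub>M\<^esub> y) (s \<otimes> t)"
    if "(x', s') \<in> frac x s" "(y', t') \<in> frac y t" for x' s' y' t'
  proof -
    from that obtain u v where
      a: "x' \<in> carrier M" "s' \<in> carrier R" "s' \<notin> P" "y' \<in> carrier M" "t' \<in> carrier R" "t' \<notin> P" and
      u: "u \<in> carrier R" "u \<notin> P" "u \<odot>\<^bsub>M\<^esub> (s' \<odot>\<^bsub>M\<^esub> x) = u \<odot>\<^bsub>M\<^esub> (s \<odot>\<^bsub>M\<^esub> x')" and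
      v: "v \<in> carrier R" "v \<notin> P" "v \<odot>\<^bsub>M\<^esub> (t' \<odot>\<^bsub>M\<^esub> y) = v \<odot>\<^bsub>M\<^esub> (t \<odot>\<^bsub>M\<^esub> y')"
      by (auto simp: frac_mem_iff)
    have "(u \<otimes> v) \<odot>\<^bsub>M\<^esub> ((s \<otimes> t) \<odot>\<^bsub>M\<^esub> (t' \<odot>\<^bsub>M\<^esub> x' \<oplus>\<^bsub>M\<^esub> s' \<odot>\<^bsub>M\<^esub> y'))
      = (v \<otimes> t \<otimes> t') \<odot>\<^bsub>M\<^esub> (u \<odot>\<^bsub>M\<^esub> (s \<odot>\<^bsub>M\<^esub> x')) \<oplus>\<^bsub>M\<^esub> (u \<otimes> s \<otimes> s') \<odot>\<^bsub>M\<^esub> (v \<odot>\<^bsub>M\<^esub> (t \<odot>\<^bsub>M\<^esub> y'))"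
      using assms a u(1) v(1) by (simp add: smult_assoc_sym smult_r_distr R.m_ac)
    also have "\<dots> = (u \<otimes> v) \<odot>\<^bsub>M\<^esub> ((s' \<otimes> t') \<odot>\<^bsub>M\<^esub> (t \<odot>\<^bsub>M\<^esub> x \<oplus>\<^bsub>M\<^esub> s \<odot>\<^bsub>M\<^esub> y))"
      unfolding u(3)[symmetric] v(3)[symmetric]
      using assms a u(1) v(1) by (simp add: smult_assoc_sym smult_r_distr R.m_ac)
    finally show ?thesis using assms a u v P.mult_notin by (subst frac_eq_iff) auto
  qed
  show ?thesis unfolding fraction_add_def
  proof (intro equalityI subsetI)
    fix p assume "p \<in> (\<Union>(x', s') \<in> frac x s. \<Union>(y', t') \<in> frac y t.
      frac (t' \<odot>\<^bsub>M\<^esub> x' \<oplus>\<^bsub>M\<^esub> s' \<odot>\<^bsub>M\<^esub> y') (s' \<otimes> t'))"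
    then show "p \<in> frac (t \<odot>\<^bsub>M\<^esub> x \<oplus>\<^bsub>M\<^esub> s \<odot>\<^bsub>M\<^esub> y) (s \<otimes> t)" using eq by auto
  next
    fix p assume "p \<in> frac (t \<odot>\<^bsub>M\<^esub> x \<oplus>\<^bsub>M\<^esub> s \<odot>\<^bsub>M\<^esub> y) (s \<otimes> t)"
    then show "p \<in> (\<Union>(x', s') \<in> frac x s. \<Union>(y', t') \<in> frac y t.
      frac (t' \<odot>\<^bsub>M\<^esub> x' \<oplus>\<^bsub>M\<^esub> s' \<odot>\<^bsub>M\<^esub> y') (s' \<otimes> t'))"
      using frac_self[of x s] frac_self[of y t] assms by blast
  qed
qed

text \<open>Independence of representatives again, now with one factor in the localized ring; its
  classes are unfolded through the instance \<open>RR\<close> for the regular module.\<close>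

lemma fraction_smult_frac:
  assumes "a \<in> carrier R" "x \<in> carrier M" "s \<in> carrier R" "s \<notin> P" "t \<in> carrier R" "t \<notin> P"
  shows "fraction_smult R M (carrier R - P) (rfrac a s) (frac x t) = frac (a \<odot>\<^bsub>M\<^esub> x) (s \<otimes> t)"
proof -
  interpret RR: module_prime P R "regular_module R"
    by (intro module_prime.intro module_regular_module) unfold_locales
  have RR: "carrier (regular_module R) = carrier R" "\<And>a b. a \<odot>\<^bsub>regular_module R\<^esub> b = a \<otimes> b"
    by (auto simp: regular_module_def)
  have eq: "frac (a' \<odot>\<^bsub>M\<^esub> x') (s' \<otimes> t') = frac (a \<odot>\<^bsub>M\<^esub> x) (s \<otimes> t)"
    if "(a', s') \<in> rfrac a s" "(x', t') \<in> frac x t" for a' s' x' t'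
  proof -
    from that(1) obtain u where
      a: "a' \<in> carrier R" "s' \<in> carrier R" "s' \<notin> P" and
      u: "u \<in> carrier R" "u \<notin> P" "u \<otimes> (s' \<otimes> a) = u \<otimes> (s \<otimes> a')"
      by (auto simp: RR.frac_mem_iff RR)
    from that(2) obtain v where
      b: "x' \<in> carrier M" "t' \<in> carrier R" "t' \<notin> P" and
      v: "v \<in> carrier R" "v \<notin> P" "v \<odot>\<^bsub>M\<^esub> (t' \<odot>\<^bsub>M\<^esub> x) = v \<odot>\<^bsub>M\<^esub> (t \<odot>\<^bsub>M\<^esub> x')"
      by (auto simp: frac_mem_iff)
    have "(u \<otimes> v) \<odot>\<^bsub>M\<^esub> ((s \<otimes> t) \<odot>\<^bsub>M\<^esub> (a' \<odot>\<^bsub>M\<^esub> x')) = (u \<otimes> (s \<otimes> a')) \<odot>\<^bsub>M\<^esub> (v \<odot>\<^bsub>M\<^esub> (t \<odot>\<^bsub>M\<^esub> x'))"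
      using assms a b u(1) v(1) by (simp add: smult_assoc_sym R.m_ac)
    also have "\<dots> = (u \<otimes> v) \<odot>\<^bsub>M\<^esub> ((s' \<otimes> t') \<odot>\<^bsub>M\<^esub> (a \<odot>\<^bsub>M\<^esub> x))"
      unfolding u(3)[symmetric] v(3)[symmetric]
      using assms a b u(1) v(1) by (simp add: smult_assoc_sym R.m_ac)
    finally show ?thesis using assms a b u v P.mult_notin by (subst frac_eq_iff) auto
  qed
  show ?thesis unfolding fraction_smult_def
  proof (intro equalityI subsetI)
    fix p assume "p \<in> (\<Union>(a', s') \<in> rfrac a s. \<Union>(x', t') \<in> frac x t.
      frac (a' \<odot>\<^bsub>M\<^esub> x') (s' \<otimes> t'))"
    then show "p \<in> frac (a \<odot>\<^bsub>M\<^esub> x) (s \<otimes> t)" using eq by auto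
  next
    fix p assume "p \<in> frac (a \<odot>\<^bsub>M\<^esub> x) (s \<otimes> t)"
    then show "p \<in> (\<Union>(a', s') \<in> rfrac a s. \<Union>(x', t') \<in> frac x t.
      frac (a' \<odot>\<^bsub>M\<^esub> x') (s' \<otimes> t'))"
      using RR.frac_self[of a s] frac_self[of x t] assms by (auto simp: RR intro!: bexI)
  qed
qed

lemma carrier_MP: "carrier MP = {frac x s | x s. x \<in> carrier M \<and> s \<in> carrier R - P}"
  by (simp add: localized_module_def fractions_def Let_def)

lemma zero_MP: "\<zero>\<^bsub>MP\<^esub> = frac \<zero>\<^bsub>M\<^esub> \<one>"
  by (simp add: localized_module_def Let_def)

lemma frac_zero: "s \<in> carrier R \<Longrightarrow> s \<notin> P \<Longrightarrow> frac \<zero>\<^bsub>M\<^esub> s = \<zero>\<^bsub>MP\<^esub>"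
  using frac_cancel[of "\<zero>\<^bsub>M\<^esub>" \<one> s] P.one_notin by (simp add: zero_MP)

lemma add_MP:
  "\<lbrakk>x \<in> carrier M; y \<in> carrier M; s \<in> carrier R; s \<notin> P; t \<in> carrier R; t \<notin> P\<rbrakk> \<Longrightarrow>
    frac x s \<oplus>\<^bsub>MP\<^esub> frac y t = frac (t \<odot>\<^bsub>M\<^esub> x \<oplus>\<^bsub>M\<^esub> s \<odot>\<^bsub>M\<^esub> y) (s \<otimes> t)"
  by (simp add: localized_module_def Let_def fraction_add_frac)

lemma carrier_RP: "carrier RP = {rfrac a s | a s. a \<in> carrier R \<and> s \<in> carrier R - P}"
  by (simp add: localized_ring_def fractions_def Let_def regular_module_def)

lemma smult_MP:
  "\<lbrakk>a \<in> carrier R; x \<in> carrier M; s \<in> carrier R; s \<notin> P; t \<in> carrier R; t \<notin> P\<rbrakk> \<Longrightarrow>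
    rfrac a s \<odot>\<^bsub>MP\<^esub> frac x t = frac (a \<odot>\<^bsub>M\<^esub> x) (s \<otimes> t)"
  by (simp add: localized_module_def Let_def fraction_smult_frac)

text \<open>The inverse is a definite description, so uniqueness is verified by hand along with
  existence. It is used for the closure under inverses that a submodule of \<open>MP\<close> must
  have.\<close>

lemma inv_MP:
  assumes x: "x \<in> carrier M" and s: "s \<in> carrier R" "s \<notin> P"
  shows "inv\<^bsub>add_monoid MP\<^esub> (frac x s) = frac (\<ominus>\<^bsub>M\<^esub> x) s"
proof -
  have ss: "s \<otimes> s \<in> carrier R" "s \<otimes> s \<notin> P" using s P.mult_notin by auto
  have 1: "frac x s \<oplus>\<^bsub>MP\<^esub> frac (\<ominus>\<^bsub>M\<^esub> x) s = \<zero>\<^bsub>MP\<^esub>"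
    using x s ss by (simp add: add_MP frac_zero M.r_neg smult_r_minus)
  have 2: "frac (\<ominus>\<^bsub>M\<^esub> x) s \<oplus>\<^bsub>MP\<^esub> frac x s = \<zero>\<^bsub>MP\<^esub>"
    using x s ss by (simp add: add_MP frac_zero M.l_neg smult_r_minus)
  have 3: "p = frac (\<ominus>\<^bsub>M\<^esub> x) s" if p: "p \<in> carrier MP" and pe: "frac x s \<oplus>\<^bsub>MP\<^esub> p = \<zero>\<^bsub>MP\<^esub>" for p
  proof -
    from p obtain y t where y: "p = frac y t" "y \<in> carrier M" "t \<in> carrier R" "t \<notin> P"
      by (auto simp: carrier_MP)
    have "frac (t \<odot>\<^bsub>M\<^esub> x \<oplus>\<^bsub>M\<^esub> s \<odot>\<^bsub>M\<^esub> y) (s \<otimes> t) = frac \<zero>\<^bsub>M\<^esub> \<one>"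
      using pe y x s by (simp add: add_MP zero_MP)
    then obtain u where u: "u \<in> carrier R" "u \<notin> P"
      "u \<odot>\<^bsub>M\<^esub> (t \<odot>\<^bsub>M\<^esub> x \<oplus>\<^bsub>M\<^esub> s \<odot>\<^bsub>M\<^esub> y) = \<zero>\<^bsub>M\<^esub>"
      using x s y P.one_notin P.mult_notin by (subst (asm) frac_eq_iff) auto
    then have "u \<odot>\<^bsub>M\<^esub> (s \<odot>\<^bsub>M\<^esub> y) = \<ominus>\<^bsub>M\<^esub> (u \<odot>\<^bsub>M\<^esub> (t \<odot>\<^bsub>M\<^esub> x))"
      using x s y by (simp add: smult_r_distr M.minus_equality[symmetric] M.a_comm)
    then have "u \<odot>\<^bsub>M\<^esub> (s \<odot>\<^bsub>M\<^esub> y) = u \<odot>\<^bsub>M\<^esub> (t \<odot>\<^bsub>M\<^esub> (\<ominus>\<^bsub>M\<^esub> x))"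
      using x s y u by (simp add: smult_r_minus)
    then show ?thesis using x s y u by (auto simp: frac_eq_iff)
  qed
  show ?thesis unfolding m_inv_def
    by (rule the_equality) (use 1 2 3 x s in \<open>auto simp: carrier_MP\<close>)
qed

section \<open>Submodules of \<open>M\<^sub>P\<close> versus saturated submodules of M\<close>

definition contraction :: "('c \<times> 'a) set set \<Rightarrow> 'c set"
  where "contraction K = {x \<in> carrier M. frac x \<one> \<in> K}"

definition extension :: "'c set \<Rightarrow> ('c \<times> 'a) set set"
  where "extension N = {frac x s | x s. x \<in> N \<and> s \<in> carrier R - P}"

lemma submodule_MPE:
  assumes "submodule K RP MP"
  shows "K \<subseteq> carrier MP" "\<zero>\<^bsub>MP\<^esub> \<in> K" "\<And>p q. \<lbrakk>p \<in> K; q \<in> K\<rbrakk> \<Longrightarrow> p \<oplus>\<^bsub>MP\<^esub> q \<in> K"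
    "\<And>a p. \<lbrakk>a \<in> carrier RP; p \<in> K\<rbrakk> \<Longrightarrow> a \<odot>\<^bsub>MP\<^esub> p \<in> K"
  using subgroup.subset[OF submodule.axioms(1)[OF assms]]
    subgroup.one_closed[OF submodule.axioms(1)[OF assms]]
    subgroup.m_closed[OF submodule.axioms(1)[OF assms]] submodule.smult_closed[OF assms]
  by auto

text \<open>The scalars s/1 and 1/s lead from each fraction to the other, so denominators do not
  affect membership in a submodule.\<close>

lemma frac_mem_submodule_iff:
  assumes K: "submodule K RP MP" and x: "x \<in> carrier M" and s: "s \<in> carrier R" "s \<notin> P"
  shows "frac x s \<in> K \<longleftrightarrow> frac x \<one> \<in> K"
proof
  assume "frac x s \<in> K"
  moreover have "rfrac s \<one> \<in> carrier RP" using s P.one_notin by (auto simp: carrier_RP)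
  ultimately have "rfrac s \<one> \<odot>\<^bsub>MP\<^esub> frac x s \<in> K" using submodule_MPE(4)[OF K] by blast
  then show "frac x \<one> \<in> K"
    using x s P.one_notin frac_cancel[of x \<one> s] by (simp add: smult_MP)
next
  assume "frac x \<one> \<in> K"
  moreover have "rfrac \<one> s \<in> carrier RP" using s by (auto simp: carrier_RP)
  ultimately have "rfrac \<one> s \<odot>\<^bsub>MP\<^esub> frac x \<one> \<in> K" using submodule_MPE(4)[OF K] by blast
  then show "frac x s \<in> K" using x s P.one_notin by (simp add: smult_MP)
qed

lemma saturated_contraction:
  assumes K: "submodule K RP MP"
  shows "saturated R M P (contraction K)"
proof -
  note KE = submodule_MPE[OF K]
  have smult: "r \<odot>\<^bsub>M\<^esub> x \<in> contraction K" if "r \<in> carrier R" "x \<in> contraction K" for r x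
  proof -
    have "rfrac r \<one> \<in> carrier RP" using that P.one_notin by (auto simp: carrier_RP)
    then have "rfrac r \<one> \<odot>\<^bsub>MP\<^esub> frac x \<one> \<in> K"
      using that KE(4) by (simp add: contraction_def)
    then show ?thesis using that P.one_notin by (auto simp: contraction_def smult_MP)
  qed
  have "submodule (contraction K) R M"
  proof (rule submoduleI)
    \<comment> \<open>Negation is treated as multiplication by the scalar -1, so that no inverses in
      \<open>MP\<close> have to be computed.\<close>
    show "\<ominus>\<^bsub>M\<^esub> x \<in> contraction K" if "x \<in> contraction K" for x
      using smult[of "\<ominus> \<one>" x] that by (simp add: smult_l_minus contraction_def)
    show "x \<oplus>\<^bsub>M\<^esub> y \<in> contraction K" if "x \<in> contraction K" "y \<in> contraction K" for x y
      using that KE(3)[of "frac x \<one>" "frac y \<one>"] P.one_notin by (simp add: contraction_def add_MP)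
    show "\<zero>\<^bsub>M\<^esub> \<in> contraction K" using KE(2) by (simp add: contraction_def zero_MP)
  qed (use smult in \<open>auto simp: contraction_def\<close>)
  moreover have "x \<in> contraction K"
    if u: "u \<in> carrier R" "u \<notin> P" and x: "x \<in> carrier M" and ux: "u \<odot>\<^bsub>M\<^esub> x \<in> contraction K" for u x
  proof -
    have "frac (u \<odot>\<^bsub>M\<^esub> x) (u \<otimes> \<one>) \<in> K"
      using ux u x frac_mem_submodule_iff[OF K, of "u \<odot>\<^bsub>M\<^esub> x" u] by (simp add: contraction_def)
    then show ?thesis using frac_cancel[of x \<one> u] u x P.one_notin by (simp add: contraction_def)
  qed
  ultimately show ?thesis by (auto simp: saturated_def)
qed

text \<open>If x/s separates \<open>L\<close> from \<open>K\<close>, so does x/1, and then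
  \<open>x\<close> separates the contractions.\<close>

lemma contraction_strict_mono:
  assumes "submodule K RP MP" and L: "submodule L RP MP" and "K \<subset> L"
  shows "contraction K \<subset> contraction L"
proof -
  from assms obtain p where p: "p \<in> L" "p \<notin> K" by auto
  then obtain x s where x: "p = frac x s" "x \<in> carrier M" "s \<in> carrier R" "s \<notin> P"
    using submodule_MPE(1)[OF L] by (auto simp: carrier_MP)
  then have "x \<in> contraction L" "x \<notin> contraction K"
    using p assms frac_mem_submodule_iff by (auto simp: contraction_def)
  then show ?thesis using assms by (auto simp: contraction_def)
qed

lemma submodule_extension:
  assumes N: "submodule N R M"
  shows "submodule (extension N) RP MP"
proof -
  note NE = submoduleE[OF N]
  have "subgroup (extension N) (add_monoid MP)"
  proof (rule subgroup.intro)
    show "extension N \<subseteq> carrier (add_monoid MP)" using NE(1) by (auto simp: extension_def carrier_MP)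
    show "p \<otimes>\<^bsub>add_monoid MP\<^esub> q \<in> extension N" if "p \<in> extension N" "q \<in> extension N" for p q
    proof -
      from that obtain x s y t where xy: "p = frac x s" "x \<in> N" "s \<in> carrier R - P"
        "q = frac y t" "y \<in> N" "t \<in> carrier R - P" by (auto simp: extension_def)
      then have "p \<oplus>\<^bsub>MP\<^esub> q = frac (t \<odot>\<^bsub>M\<^esub> x \<oplus>\<^bsub>M\<^esub> s \<odot>\<^bsub>M\<^esub> y) (s \<otimes> t)"
        using NE(1) by (auto simp: add_MP subsetD)
      moreover have "t \<odot>\<^bsub>M\<^esub> x \<oplus>\<^bsub>M\<^esub> s \<odot>\<^bsub>M\<^esub> y \<in> N" "s \<otimes> t \<in> carrier R - P"
        using xy NE(4,5) P.mult_notin by auto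
      ultimately show ?thesis by (auto simp: extension_def)
    qed
    show "\<one>\<^bsub>add_monoid MP\<^esub> \<in> extension N"
      using submodule_zero_closed[OF N] P.one_notin by (auto simp: extension_def zero_MP)
    show "inv\<^bsub>add_monoid MP\<^esub> p \<in> extension N" if "p \<in> extension N" for p
    proof -
      from that obtain x s where "p = frac x s" "x \<in> N" "s \<in> carrier R - P"
        by (auto simp: extension_def)
      with NE(1,3) show ?thesis by (auto simp: inv_MP extension_def subsetD)
    qed
  qed
  moreover have "a \<odot>\<^bsub>MP\<^esub> p \<in> extension N" if "a \<in> carrier RP" "p \<in> extension N" for a p
  proof -
    from that obtain b s x t where b: "a = rfrac b s" "b \<in> carrier R" "s \<in> carrier R - P"
      "p = frac x t" "x \<in> N" "t \<in> carrier R - P" by (auto simp: extension_def carrier_RP)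
    then have "a \<odot>\<^bsub>MP\<^esub> p = frac (b \<odot>\<^bsub>M\<^esub> x) (s \<otimes> t)" using NE(1) by (auto simp: smult_MP subsetD)
    moreover have "b \<odot>\<^bsub>M\<^esub> x \<in> N" "s \<otimes> t \<in> carrier R - P" using b NE(4) P.mult_notin by auto
    ultimately show ?thesis by (auto simp: extension_def)
  qed
  ultimately show ?thesis by (simp add: submodule.intro submodule_axioms.intro)
qed

text \<open>Saturation keeps the inclusion strict: if x/1 = y/s with \<open>y \<in> N\<close>, then
  some \<open>u\<close> outside \<open>P\<close> satisfies u s x = u y, which lies in
  \<open>N\<close>, and this forces \<open>x \<in> N\<close>.\<close>

lemma extension_strict_mono:
  assumes N: "saturated R M P N" and L: "saturated R M P L" and NL: "N \<subset> L"
  shows "extension N \<subset> extension L"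
proof -
  from NL obtain x where x: "x \<in> L" "x \<notin> N" by auto
  note NE = submoduleE[OF saturatedD(1)[OF N]] and LE = submoduleE[OF saturatedD(1)[OF L]]
  have xM: "x \<in> carrier M" using x LE(1) by auto
  have "frac x \<one> \<notin> extension N"
  proof
    assume "frac x \<one> \<in> extension N"
    then obtain y s where y: "frac x \<one> = frac y s" "y \<in> N" "s \<in> carrier R" "s \<notin> P"
      by (auto simp: extension_def)
    then have yM: "y \<in> carrier M" using NE(1) by auto
    with y xM obtain u where u: "u \<in> carrier R" "u \<notin> P" "u \<odot>\<^bsub>M\<^esub> (s \<odot>\<^bsub>M\<^esub> x) = u \<odot>\<^bsub>M\<^esub> (\<one> \<odot>\<^bsub>M\<^esub> y)"
      using frac_eq_iff[of x y \<one> s] P.one_notin by auto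
    then have "u \<odot>\<^bsub>M\<^esub> (s \<odot>\<^bsub>M\<^esub> x) \<in> N" using NE(4) y yM by simp
    then show False using saturatedD(2)[OF N] u y x xM by (meson smult_closed)
  qed
  moreover have "frac x \<one> \<in> extension L" using x P.one_notin unfolding extension_def by blast
  moreover have "extension N \<subseteq> extension L" using NL unfolding extension_def by blast
  ultimately show ?thesis by blast
qed

section \<open>The length of \<open>M\<^sub>P\<close>\<close>

text \<open>Contraction turns a strict chain in \<open>MP\<close> into a strict chain of saturated
  submodules. Along it the height \<open>d\<close> rises by at least one at each inclusion, so its
  bound \<open>n\<close> also bounds the number of inclusions.\<close>

lemma module_length_MP_finite:
  assumes "bounded_chains R M P (carrier M)"
  shows "module_length RP MP < \<infinity>"
proof -
  from assms obtain d :: "'c set \<Rightarrow> nat" and n where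
    dn: "\<And>C. saturated R M P C \<Longrightarrow> C \<subseteq> carrier M \<Longrightarrow> d C \<le> n" and
    mono: "\<And>C D. \<lbrakk>saturated R M P C; saturated R M P D; C \<subset> D; D \<subseteq> carrier M\<rbrakk> \<Longrightarrow> d C < d D"
    unfolding bounded_chains_def by metis
  have sub: "contraction K \<subseteq> carrier M" for K by (auto simp: contraction_def)
  have "k \<le> n" if C: "\<And>i. i \<le> k \<Longrightarrow> submodule (C i) RP MP" "\<And>i. i < k \<Longrightarrow> C i \<subset> C (Suc i)"
    for k and C :: "nat \<Rightarrow> ('c \<times> 'a) set set"
  proof -
    have "i \<le> d (contraction (C i))" if "i \<le> k" for i
      using that
    proof (induction i)
      case (Suc i)
      then have i: "i < k" by simp
      have "d (contraction (C i)) < d (contraction (C (Suc i)))"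
        using C(1)[of i] C(1)[of "Suc i"] C(2)[of i] Suc.prems
        by (intro mono saturated_contraction contraction_strict_mono sub) auto
      with Suc show ?case by simp
    qed simp
    from this[of k] dn[OF saturated_contraction[OF C(1)[of k]] sub] show ?thesis by simp
  qed
  then have "module_length RP MP \<le> enat n"
    unfolding module_length_def by (intro SUP_least) auto
  then show ?thesis by (metis enat_ord_simps(4) enat.distinct(1) order_le_less_trans less_infinityE not_infinity_eq)
qed

text \<open>A module of finite length is its own largest submodule of finite length.\<close>

lemma finlen_MP:
  assumes "bounded_chains R M P (carrier M)"
  shows "finlen RP MP = module_length RP MP"
proof -
  have "extension (carrier M) = carrier MP" by (auto simp: extension_def carrier_MP)
  then have "submodule (carrier MP) RP MP" using submodule_extension[OF carrier_is_submodule] by simp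
  then have "largest_finite_length_submodule RP MP = carrier MP"
    unfolding largest_finite_length_submodule_def
    using module_length_MP_finite[OF assms] submodule_MPE(1) by (intro Greatest_equality) auto
  then show ?thesis by (simp add: finlen_def)
qed

lemma no_chain_of_length_two:
  assumes len: "module_length RP MP = 1"
    and sat: "saturated R M P A" "saturated R M P B" "saturated R M P C"
    and chain: "A \<subset> B" "B \<subset> C"
  shows False
proof -
  \<comment> \<open>\<open>module_length\<close> counts strict inclusions and not terms, so three
    submodules at the indices 0, 1, 2 witness length at least 2.\<close>
  define D where "D i = extension (if i = 0 then A else if i = Suc 0 then B else C)" for i :: nat
  have "\<forall>i\<le>2. submodule (D i) RP MP"
    using sat by (auto simp: D_def intro!: submodule_extension dest: saturatedD(1))
  moreover have "\<forall>i<2. D i \<subset> D (Suc i)"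
    using extension_strict_mono[OF sat(1,2) chain(1)] extension_strict_mono[OF sat(2,3) chain(2)]
    by (auto simp: D_def less_Suc_eq numeral_2_eq_2)
  ultimately have "enat 2 \<le> module_length RP MP"
    unfolding module_length_def by (intro SUP_upper) auto
  with len show False by (simp add: one_enat_def)
qed

end

text \<open>Here the two hypotheses meet: the absence of embedded primes makes
  \<open>M\<^sub>P\<close> a module of finite length, and binarity then makes that length 1. The
  simple module \<open>M\<^sub>P\<close> is generated by the nonzero element y/1, and
  \<open>v\<close> clears all denominators at once.\<close>

lemma (in module) binary_generically_cyclic:
  assumes noeth: "noetherian_ring R" and fg: "finitely_generated_module R M"
    and bin: "binary_module R M" and emb: "embedded_primes R M = {}"
    and P: "P \<in> associated_primes R M"
  obtains y v where "y \<in> carrier M" and "P = elem_annihilator R M y" and "v \<in> carrier R" and "v \<notin> P"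
    and "\<And>x. x \<in> carrier M \<Longrightarrow> \<exists>r \<in> carrier R. v \<odot>\<^bsub>M\<^esub> x = r \<odot>\<^bsub>M\<^esub> y"
proof -
  from P obtain y where y: "y \<in> carrier M" "P = elem_annihilator R M y" and pr: "primeideal P R"
    by (auto simp: associated_primes_def)
  interpret module_prime P R M by (intro module_prime.intro module_axioms pr)
  \<comment> \<open>A prime between the annihilator and \<open>P\<close> contains an associated
    prime, which cannot be strictly below \<open>P\<close>. Hence \<open>P\<close> is minimal over
    the annihilator.\<close>
  have "Q = P" if Q: "primeideal Q R" "annihilator R M \<subseteq> Q" "Q \<subseteq> P" for Q
  proof -
    obtain P' where P': "P' \<in> associated_primes R M" "P' \<subseteq> Q"
      using associated_prime_below[OF noeth fg Q(1,2)] .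
    with emb P have "\<not> P' \<subset> P" by (auto simp: embedded_primes_def)
    with P' Q show ?thesis by auto
  qed
  then have bd: "bounded_chains R M P (carrier M)" by (rule bounded_chains_carrier[OF noeth fg pr])
  have len: "module_length RP MP = 1" using bin P finlen_MP[OF bd] by (auto simp: binary_module_def)
  let ?L = "(\<lambda>r. r \<odot>\<^bsub>M\<^esub> y) ` carrier R"
  have L: "submodule ?L R M" by (rule cyclic_submodule[OF y(1)])
  have "y \<in> ?L" using y(1) by (metis R.one_closed image_eqI smult_one)
  then have "y \<in> saturation R M P ?L" using subset_saturation[OF pr L] by auto
  moreover have "y \<notin> saturation R M P {\<zero>\<^bsub>M\<^esub>}"
  proof
    assume "y \<in> saturation R M P {\<zero>\<^bsub>M\<^esub>}"
    then obtain u where "u \<in> carrier R" "u \<notin> P" "u \<odot>\<^bsub>M\<^esub> y = \<zero>\<^bsub>M\<^esub>" unfolding saturation_def by blast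
    then show False unfolding y(2) elem_annihilator_def by blast
  qed
  ultimately have "saturation R M P {\<zero>\<^bsub>M\<^esub>} \<subset> saturation R M P ?L"
    using saturation_zero_subset[OF saturated_saturation[OF pr L]] by blast
  \<comment> \<open>Otherwise the saturations of 0 and of R y, followed by M, would form a chain
    with two strict inclusions.\<close>
  then have "saturation R M P ?L = carrier M"
    using no_chain_of_length_two[OF len saturated_saturation[OF pr zero_submodule]
      saturated_saturation[OF pr L] saturated_carrier] by (auto simp: saturation_def)
  then obtain v where v: "v \<in> carrier R" "v \<notin> P" "\<And>x. x \<in> carrier M \<Longrightarrow> v \<odot>\<^bsub>M\<^esub> x \<in> ?L"
    using finitely_generated_common_multiplier[OF pr fg L] by blast
  show thesis by (rule that[OF y v(1,2)]) (use v(3) in blast)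
qed

section \<open>Modules isomorphic to ideals\<close>

lemma (in primeideal) pow_mem_imp_mem:
  fixes n :: nat
  assumes "a \<in> carrier R" and "a [^] n \<in> I"
  shows "a \<in> I"
  using assms(2)
proof (induction n)
  case (Suc n)
  then show ?case using I_prime[of "a [^] n" a] assms(1) by auto
qed (simp add: one_notin)

lemma (in ideal) finsum_closed:
  assumes "finite A" and "f \<in> A \<rightarrow> I"
  shows "finsum R f A \<in> I"
  using assms
proof (induction A)
  case (insert a A)
  then have "f \<in> A \<rightarrow> carrier R" "f a \<in> carrier R" using Icarr by blast+
  then have "finsum R f (insert a A) = f a \<oplus> finsum R f A"
    using insert by (simp add: finsum_insert)
  with insert show ?case by auto
qed simp

section \<open>Patching the local generators\<close>

text \<open>The first conditions say that multiplication by \<open>s\<close> embeds M into R x. The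
  last one, which holds because each summand of \<open>x\<close> has an associated prime as its
  annihilator, later gives radicality.\<close>

lemma (in module) binary_embedding_data:
  assumes noeth: "noetherian_ring R" and fg: "finitely_generated_module R M"
    and bin: "binary_module R M" and emb: "embedded_primes R M = {}"
  obtains x s where "x \<in> carrier M" and "s \<in> carrier R"
    and "\<And>m. m \<in> carrier M \<Longrightarrow> \<exists>r \<in> carrier R. s \<odot>\<^bsub>M\<^esub> m = r \<odot>\<^bsub>M\<^esub> x"
    and "\<And>m. \<lbrakk>m \<in> carrier M; s \<odot>\<^bsub>M\<^esub> m = \<zero>\<^bsub>M\<^esub>\<rbrakk> \<Longrightarrow> m = \<zero>\<^bsub>M\<^esub>"
    and "\<And>c. \<lbrakk>c \<in> carrier R; \<forall>P \<in> associated_primes R M. c \<in> P\<rbrakk> \<Longrightarrow> c \<odot>\<^bsub>M\<^esub> x = \<zero>\<^bsub>M\<^esub>"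
proof -
  interpret noetherian_ring R by (rule noeth)
  let ?Ass = "associated_primes R M"
  have "\<forall>P \<in> ?Ass. \<exists>y v. y \<in> carrier M \<and> P = elem_annihilator R M y \<and> v \<in> carrier R \<and> v \<notin> P \<and>
    (\<forall>m \<in> carrier M. \<exists>r \<in> carrier R. v \<odot>\<^bsub>M\<^esub> m = r \<odot>\<^bsub>M\<^esub> y)"
    using binary_generically_cyclic[OF noeth fg bin emb] by metis
  then obtain y v where yv: "\<And>P. P \<in> ?Ass \<Longrightarrow> y P \<in> carrier M"
    "\<And>P. P \<in> ?Ass \<Longrightarrow> P = elem_annihilator R M (y P)"
    "\<And>P. P \<in> ?Ass \<Longrightarrow> v P \<in> carrier R" "\<And>P. P \<in> ?Ass \<Longrightarrow> v P \<notin> P"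
    "\<And>P m. P \<in> ?Ass \<Longrightarrow> m \<in> carrier M \<Longrightarrow> \<exists>r \<in> carrier R. v P \<odot>\<^bsub>M\<^esub> m = r \<odot>\<^bsub>M\<^esub> y P"
    by metis
  have prime: "primeideal P R" if "P \<in> ?Ass" for P using that by (simp add: associated_primes_def)
  have kill: "c \<odot>\<^bsub>M\<^esub> y P = \<zero>\<^bsub>M\<^esub>" if "P \<in> ?Ass" "c \<in> P" for c P
    using yv(2)[OF that(1)] that(2) unfolding elem_annihilator_def by blast
  have vQ: "v P \<in> Q" if P: "P \<in> ?Ass" and Q: "Q \<in> ?Ass" and neq: "P \<noteq> Q" for P Q
  proof -
    have "\<not> P \<subset> Q" using emb P Q by (auto simp: embedded_primes_def)
    then obtain p where p: "p \<in> P" "p \<notin> Q" using neq by auto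
    have pR: "p \<in> carrier R" using p ideal.Icarr[OF primeideal.axioms(1)[OF prime[OF P]]] by blast
    \<comment> \<open>Multiplying by \<open>v P\<close> sends M into R \<open>y P\<close>, which
      \<open>p \<in> P\<close> kills. The product thus lies in every associated prime, in particular
      in \<open>Q\<close>, where \<open>p\<close> does not.\<close>
    have "v P \<otimes> p \<in> annihilator R M"
      unfolding annihilator_def
    proof (intro CollectI conjI ballI)
      fix m assume m: "m \<in> carrier M"
      then obtain r where r: "r \<in> carrier R" "v P \<odot>\<^bsub>M\<^esub> m = r \<odot>\<^bsub>M\<^esub> y P" using yv(5)[OF P] by blast
      have "(v P \<otimes> p) \<odot>\<^bsub>M\<^esub> m = p \<odot>\<^bsub>M\<^esub> (v P \<odot>\<^bsub>M\<^esub> m)"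
        using yv(3)[OF P] pR m by (subst R.m_comm) (auto simp: smult_assoc1)
      also have "\<dots> = r \<odot>\<^bsub>M\<^esub> (p \<odot>\<^bsub>M\<^esub> y P)"
        using r pR yv(1)[OF P] by (simp add: smult_assoc1[symmetric] R.m_comm)
      finally show "(v P \<otimes> p) \<odot>\<^bsub>M\<^esub> m = \<zero>\<^bsub>M\<^esub>" using kill[OF P p(1)] r by simp
    qed (use yv(3)[OF P] pR in simp)
    then have "v P \<otimes> p \<in> Q"
      using annihilator_subset_elem_annihilator[OF yv(1)[OF Q], of R] yv(2)[OF Q] by blast
    then show ?thesis using primeideal.I_prime[OF prime[OF Q] yv(3)[OF P] pR] p(2) by blast
  qed
  have fin: "finite ?Ass"
  proof -
    \<comment> \<open>If the finite set \<open>A\<close> gives a maximal ideal of this form, an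
      associated prime \<open>P\<close> outside \<open>A\<close> would contain that ideal, since it
      contains all other \<open>v Q\<close>; but maximality puts \<open>v P\<close> into the ideal
      as well.\<close>
    define F where "F = {Idl (v ` A) | A. finite A \<and> A \<subseteq> ?Ass}"
    have car: "v ` A \<subseteq> carrier R" if "A \<subseteq> ?Ass" for A using that yv(3) by auto
    have "F \<noteq> {}" by (auto simp: F_def)
    moreover have "ideal I R" if "I \<in> F" for I using that car by (auto simp: F_def intro!: genideal_ideal)
    ultimately obtain I where I: "I \<in> F" and max: "\<And>J. J \<in> F \<Longrightarrow> I \<subseteq> J \<Longrightarrow> J = I"
      using exists_maximal_ideal_in by metis
    then obtain A where A: "I = Idl (v ` A)" "finite A" "A \<subseteq> ?Ass" by (auto simp: F_def)
    have "?Ass \<subseteq> A"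
    proof (rule ccontr)
      assume "\<not> ?Ass \<subseteq> A"
      then obtain P where P: "P \<in> ?Ass" "P \<notin> A" by auto
      have 1: "insert P A \<subseteq> ?Ass" using A P by auto
      then have "Idl (v ` insert P A) \<in> F" using A(2) unfolding F_def by blast
      moreover have "I \<subseteq> Idl (v ` insert P A)"
        unfolding A(1) by (rule subset_Idl_subset[OF car[OF 1]]) auto
      ultimately have "Idl (v ` insert P A) = I" by (rule max)
      moreover have "v P \<in> Idl (v ` insert P A)" using genideal_self[OF car[OF 1]] by auto
      moreover have "I \<subseteq> P" unfolding A(1)
        by (rule genideal_minimal[OF primeideal.axioms(1)[OF prime[OF P(1)]]]) (use vQ A P in blast)
      ultimately show False using yv(4)[OF P(1)] by auto
    qed
    then show ?thesis using A(2) finite_subset by blast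
  qed
  have y: "y \<in> ?Ass \<rightarrow> carrier M" using yv(1) by auto
  define x where "x = (\<Oplus>\<^bsub>M\<^esub>P \<in> ?Ass. y P)"
  \<comment> \<open>Squares are needed: one factor \<open>v P\<close> carries \<open>m\<close> to a
    multiple of \<open>y P\<close>, the other replaces \<open>y P\<close> by
    \<open>x\<close>.\<close>
  define s where "s = (\<Oplus>P \<in> ?Ass. v P \<otimes> v P)"
  have x: "x \<in> carrier M" using y by (simp add: x_def)
  have s: "s \<in> carrier R" using yv(3) by (auto simp: s_def)
  have cx: "c \<odot>\<^bsub>M\<^esub> x = (\<Oplus>\<^bsub>M\<^esub>P \<in> ?Ass. c \<odot>\<^bsub>M\<^esub> y P)" if "c \<in> carrier R" for c
    unfolding x_def by (rule finsum_smult_ldistr[OF fin that y])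
  have vx: "v P \<odot>\<^bsub>M\<^esub> x = v P \<odot>\<^bsub>M\<^esub> y P" if P: "P \<in> ?Ass" for P
  proof -
    \<comment> \<open>All terms with \<open>Q \<noteq> P\<close> vanish, because \<open>v P\<close>
      lies in \<open>Q\<close>, the annihilator of \<open>y Q\<close>.\<close>
    have "(\<Oplus>\<^bsub>M\<^esub>Q \<in> ?Ass. v P \<odot>\<^bsub>M\<^esub> y Q) = (\<Oplus>\<^bsub>M\<^esub>Q \<in> ?Ass. if P = Q then v P \<odot>\<^bsub>M\<^esub> y Q else \<zero>\<^bsub>M\<^esub>)"
      by (rule M.finsum_cong') (use kill vQ[OF P] yv(1) yv(3)[OF P] in auto)
    also have "\<dots> = v P \<odot>\<^bsub>M\<^esub> y P"
      using M.add.finprod_singleton[OF P fin, of "\<lambda>Q. v P \<odot>\<^bsub>M\<^esub> y Q"] yv(1) yv(3)[OF P] by auto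
    finally show ?thesis using cx yv(3)[OF P] by simp
  qed
  have cyclic: "\<exists>r \<in> carrier R. s \<odot>\<^bsub>M\<^esub> m = r \<odot>\<^bsub>M\<^esub> x" if m: "m \<in> carrier M" for m
  proof -
    \<comment> \<open>The scalars that carry \<open>m\<close> into R x form an ideal, so it suffices
      to check each summand of \<open>s\<close>.\<close>
    let ?K = "colon R M ((\<lambda>r. r \<odot>\<^bsub>M\<^esub> x) ` carrier R) m"
    have "v P \<otimes> v P \<in> ?K" if P: "P \<in> ?Ass" for P
    proof -
      obtain r where r: "r \<in> carrier R" "v P \<odot>\<^bsub>M\<^esub> m = r \<odot>\<^bsub>M\<^esub> y P" using yv(5)[OF P m] by blast
      have "(v P \<otimes> v P) \<odot>\<^bsub>M\<^esub> m = (v P \<otimes> r) \<odot>\<^bsub>M\<^esub> y P"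
        using r yv(1,3)[OF P] m by (simp add: smult_assoc1)
      also have "\<dots> = (r \<otimes> v P) \<odot>\<^bsub>M\<^esub> x"
        using r yv(1,3)[OF P] x vx[OF P] by (simp add: smult_assoc1 R.m_comm[of "v P" r])
      finally show ?thesis using r yv(3)[OF P] by (auto simp: colon_def)
    qed
    then have "s \<in> ?K" unfolding s_def
      by (intro ideal.finsum_closed[OF ideal_colon[OF cyclic_submodule[OF x] m] fin]) auto
    then show ?thesis by (auto simp: colon_def)
  qed
  \<comment> \<open>Modulo \<open>P\<close> only the summand \<open>v P \<otimes> v P\<close> of
    \<open>s\<close> survives.\<close>
  have sP: "s \<notin> P" if P: "P \<in> ?Ass" for P
  proof
    assume sP: "s \<in> P"
    interpret P: primeideal P R by (rule prime[OF P])
    let ?rest = "\<Oplus>Q \<in> ?Ass - {P}. v Q \<otimes> v Q"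
    have rest: "?rest \<in> P"
      by (rule P.finsum_closed) (use fin vQ P yv(3) P.I_l_closed in auto)
    have "s = finsum R (\<lambda>Q. v Q \<otimes> v Q) (insert P (?Ass - {P}))"
      unfolding s_def using P by (simp add: insert_absorb)
    also have "\<dots> = v P \<otimes> v P \<oplus> ?rest"
      by (rule R.finsum_insert) (use fin P yv(3) in auto)
    finally have "v P \<otimes> v P = s \<oplus> \<ominus> ?rest"
      using yv(3)[OF P] P.Icarr[OF rest] by (simp add: R.a_assoc R.r_neg)
    also have "\<dots> \<in> P" using sP rest by blast
    finally show False using P.I_prime yv(3,4)[OF P] by blast
  qed
  \<comment> \<open>A nonzero \<open>m\<close> has a multiple whose annihilator is an associated
    prime; if \<open>s\<close> killed \<open>m\<close>, it would lie in that prime.\<close>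
  have inj: "m = \<zero>\<^bsub>M\<^esub>" if m: "m \<in> carrier M" "s \<odot>\<^bsub>M\<^esub> m = \<zero>\<^bsub>M\<^esub>" for m
  proof (rule ccontr)
    assume "m \<noteq> \<zero>\<^bsub>M\<^esub>"
    then obtain r where r: "r \<in> carrier R" "primeideal (elem_annihilator R M (r \<odot>\<^bsub>M\<^esub> m)) R"
      using prime_colon[OF noeth zero_submodule m(1)] by (auto simp: colon_zero)
    then have "elem_annihilator R M (r \<odot>\<^bsub>M\<^esub> m) \<in> ?Ass" using m(1) by (auto simp: associated_primes_def)
    then have "s \<odot>\<^bsub>M\<^esub> (r \<odot>\<^bsub>M\<^esub> m) \<noteq> \<zero>\<^bsub>M\<^esub>" using sP s by (auto simp: elem_annihilator_def)
    moreover have "s \<odot>\<^bsub>M\<^esub> (r \<odot>\<^bsub>M\<^esub> m) = r \<odot>\<^bsub>M\<^esub> (s \<odot>\<^bsub>M\<^esub> m)"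
      using s r m(1) by (simp add: smult_assoc1[symmetric] R.m_comm)
    ultimately show False using m r by simp
  qed
  have "c \<odot>\<^bsub>M\<^esub> x = \<zero>\<^bsub>M\<^esub>" if c: "c \<in> carrier R" "\<forall>P \<in> ?Ass. c \<in> P" for c
    unfolding cx[OF c(1)] by (rule M.add.finprod_one_eqI) (use c kill in auto)
  then show thesis using that[OF x s cyclic inj] by blast
qed

section \<open>The ring structure of \<open>End_ring\<close>\<close>

lemma (in abelian_group) add_minus_eq_zero_iff:
  "\<lbrakk>x \<in> carrier G; y \<in> carrier G\<rbrakk> \<Longrightarrow> x \<oplus> \<ominus> y = \<zero> \<longleftrightarrow> x = y"
  by (metis a_inv_closed minus_equality minus_minus r_neg)

text \<open>Members of the carrier are extensional, so by \<open>eq\<close> each ring law reduces to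
  a pointwise identity on \<open>carrier M\<close>.\<close>

lemma (in module) ring_End_ring: "ring (End_ring R M)"
proof -
  note ext = extensionalityI[where A = "carrier M"]
  have eq: "f = g" if "f \<in> carrier (End_ring R M)" "g \<in> carrier (End_ring R M)"
    "\<And>x. x \<in> carrier M \<Longrightarrow> f x = g x" for f g
    by (rule ext) (use that in \<open>auto simp: End_ring_def\<close>)
  have car: "f x \<in> carrier M" if "f \<in> carrier (End_ring R M)" "x \<in> carrier M" for f x
    using that by (auto simp: End_ring_def module_hom_def)
  have hadd: "f (x \<oplus>\<^bsub>M\<^esub> y) = f x \<oplus>\<^bsub>M\<^esub> f y"
    if "f \<in> carrier (End_ring R M)" "x \<in> carrier M" "y \<in> carrier M" for f x y
    using that by (auto simp: End_ring_def module_hom_def)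
  have hsm: "f (r \<odot>\<^bsub>M\<^esub> x) = r \<odot>\<^bsub>M\<^esub> f x"
    if "f \<in> carrier (End_ring R M)" "r \<in> carrier R" "x \<in> carrier M" for f r x
    using that by (auto simp: End_ring_def module_hom_def)
  have intro: "(\<lambda>x \<in> carrier M. h x) \<in> carrier (End_ring R M)"
    if "\<And>x. x \<in> carrier M \<Longrightarrow> h x \<in> carrier M"
      "\<And>x y. \<lbrakk>x \<in> carrier M; y \<in> carrier M\<rbrakk> \<Longrightarrow> h (x \<oplus>\<^bsub>M\<^esub> y) = h x \<oplus>\<^bsub>M\<^esub> h y"
      "\<And>r x. \<lbrakk>r \<in> carrier R; x \<in> carrier M\<rbrakk> \<Longrightarrow> h (r \<odot>\<^bsub>M\<^esub> x) = r \<odot>\<^bsub>M\<^esub> h x" for h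
    using that by (auto simp: End_ring_def module_hom_def)
  have add: "f \<oplus>\<^bsub>End_ring R M\<^esub> g = (\<lambda>x \<in> carrier M. f x \<oplus>\<^bsub>M\<^esub> g x)" for f g by (simp add: End_ring_def)
  have mult: "f \<otimes>\<^bsub>End_ring R M\<^esub> g = (\<lambda>x \<in> carrier M. f (g x))" for f g
    by (simp add: End_ring_def compose_def)
  have one: "\<one>\<^bsub>End_ring R M\<^esub> = (\<lambda>x \<in> carrier M. x)"
    and zero: "\<zero>\<^bsub>End_ring R M\<^esub> = (\<lambda>x \<in> carrier M. \<zero>\<^bsub>M\<^esub>)" by (simp_all add: End_ring_def)
  have add_closed: "f \<oplus>\<^bsub>End_ring R M\<^esub> g \<in> carrier (End_ring R M)"
    if "f \<in> carrier (End_ring R M)" "g \<in> carrier (End_ring R M)" for f g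
    unfolding add by (rule intro) (use that in \<open>auto simp: car hadd hsm smult_r_distr M.a_ac\<close>)
  have mult_closed: "f \<otimes>\<^bsub>End_ring R M\<^esub> g \<in> carrier (End_ring R M)"
    if "f \<in> carrier (End_ring R M)" "g \<in> carrier (End_ring R M)" for f g
    unfolding mult by (rule intro) (use that in \<open>auto simp: car hadd hsm\<close>)
  have zero_closed: "\<zero>\<^bsub>End_ring R M\<^esub> \<in> carrier (End_ring R M)"
    unfolding zero by (rule intro) auto
  have one_closed: "\<one>\<^bsub>End_ring R M\<^esub> \<in> carrier (End_ring R M)"
    unfolding one by (rule intro) auto
  have neg_closed: "(\<lambda>x \<in> carrier M. \<ominus>\<^bsub>M\<^esub> f x) \<in> carrier (End_ring R M)"
    if "f \<in> carrier (End_ring R M)" for f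
    by (rule intro) (use that in \<open>auto simp: car hadd hsm smult_r_minus M.minus_add\<close>)
  show ?thesis
  proof (rule ringI)
    show "abelian_group (End_ring R M)"
    proof (rule abelian_groupI)
      fix f assume f: "f \<in> carrier (End_ring R M)"
      then have "(\<lambda>x \<in> carrier M. \<ominus>\<^bsub>M\<^esub> f x) \<oplus>\<^bsub>End_ring R M\<^esub> f = \<zero>\<^bsub>End_ring R M\<^esub>"
        by (intro eq add_closed neg_closed zero_closed) (auto simp: add zero car M.l_neg)
      then show "\<exists>g \<in> carrier (End_ring R M). g \<oplus>\<^bsub>End_ring R M\<^esub> f = \<zero>\<^bsub>End_ring R M\<^esub>"
        using neg_closed[OF f] by blast
    next
      fix f g h assume "f \<in> carrier (End_ring R M)" "g \<in> carrier (End_ring R M)" "h \<in> carrier (End_ring R M)"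
      then show "f \<oplus>\<^bsub>End_ring R M\<^esub> g \<oplus>\<^bsub>End_ring R M\<^esub> h = f \<oplus>\<^bsub>End_ring R M\<^esub> (g \<oplus>\<^bsub>End_ring R M\<^esub> h)"
        by (intro eq add_closed) (auto simp: add car M.a_assoc)
    next
      fix f g assume "f \<in> carrier (End_ring R M)" "g \<in> carrier (End_ring R M)"
      then show "f \<oplus>\<^bsub>End_ring R M\<^esub> g = g \<oplus>\<^bsub>End_ring R M\<^esub> f"
        by (intro eq add_closed) (auto simp: add car M.a_comm)
    next
      fix f assume "f \<in> carrier (End_ring R M)"
      then show "\<zero>\<^bsub>End_ring R M\<^esub> \<oplus>\<^bsub>End_ring R M\<^esub> f = f"
        by (intro eq add_closed zero_closed) (auto simp: add zero car)
    qed (fact add_closed zero_closed)+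
    show "monoid (End_ring R M)"
    proof (rule monoidI)
      fix f g h assume "f \<in> carrier (End_ring R M)" "g \<in> carrier (End_ring R M)" "h \<in> carrier (End_ring R M)"
      then show "f \<otimes>\<^bsub>End_ring R M\<^esub> g \<otimes>\<^bsub>End_ring R M\<^esub> h = f \<otimes>\<^bsub>End_ring R M\<^esub> (g \<otimes>\<^bsub>End_ring R M\<^esub> h)"
        by (intro eq mult_closed) (auto simp: mult car)
    next
      fix f assume f: "f \<in> carrier (End_ring R M)"
      show "\<one>\<^bsub>End_ring R M\<^esub> \<otimes>\<^bsub>End_ring R M\<^esub> f = f"
        using f by (intro eq mult_closed one_closed) (auto simp: mult one car)
      show "f \<otimes>\<^bsub>End_ring R M\<^esub> \<one>\<^bsub>End_ring R M\<^esub> = f"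
        using f by (intro eq mult_closed one_closed) (auto simp: mult one car)
    qed (fact mult_closed one_closed)+
  next
    fix f g h assume fgh: "f \<in> carrier (End_ring R M)" "g \<in> carrier (End_ring R M)" "h \<in> carrier (End_ring R M)"
    show "(f \<oplus>\<^bsub>End_ring R M\<^esub> g) \<otimes>\<^bsub>End_ring R M\<^esub> h = f \<otimes>\<^bsub>End_ring R M\<^esub> h \<oplus>\<^bsub>End_ring R M\<^esub> g \<otimes>\<^bsub>End_ring R M\<^esub> h"
      using fgh by (intro eq mult_closed add_closed) (auto simp: mult add car)
    show "h \<otimes>\<^bsub>End_ring R M\<^esub> (f \<oplus>\<^bsub>End_ring R M\<^esub> g) = h \<otimes>\<^bsub>End_ring R M\<^esub> f \<oplus>\<^bsub>End_ring R M\<^esub> h \<otimes>\<^bsub>End_ring R M\<^esub> g"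
      using fgh by (intro eq mult_closed add_closed) (auto simp: mult add car hadd)
  qed
qed

section \<open>Consequences of an embedding into a cyclic submodule\<close>

text \<open>Abstracts from Ass and localization: all that remains is that multiplication by
  \<open>s\<close> maps M injectively into R x.\<close>

locale module_embedded_in_cyclic = module R M for R (structure) and M (structure) +
  fixes x s
  assumes x_closed: "x \<in> carrier M" and s_closed: "s \<in> carrier R"
    and s_cyclic: "m \<in> carrier M \<Longrightarrow> \<exists>r \<in> carrier R. s \<odot>\<^bsub>M\<^esub> m = r \<odot>\<^bsub>M\<^esub> x"
    and s_inj: "\<lbrakk>m \<in> carrier M; s \<odot>\<^bsub>M\<^esub> m = \<zero>\<^bsub>M\<^esub>\<rbrakk> \<Longrightarrow> m = \<zero>\<^bsub>M\<^esub>"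
begin

lemma smult_left_commute:
  "\<lbrakk>a \<in> carrier R; b \<in> carrier R; m \<in> carrier M\<rbrakk> \<Longrightarrow> a \<odot>\<^bsub>M\<^esub> (b \<odot>\<^bsub>M\<^esub> m) = b \<odot>\<^bsub>M\<^esub> (a \<odot>\<^bsub>M\<^esub> m)"
  by (metis R.m_comm smult_assoc1)

lemma s_cancel:
  assumes "m \<in> carrier M" and "n \<in> carrier M" and "s \<odot>\<^bsub>M\<^esub> m = s \<odot>\<^bsub>M\<^esub> n"
  shows "m = n"
proof -
  have "s \<odot>\<^bsub>M\<^esub> (m \<oplus>\<^bsub>M\<^esub> \<ominus>\<^bsub>M\<^esub> n) = \<zero>\<^bsub>M\<^esub>"
    using assms s_closed by (simp add: smult_r_distr smult_r_minus M.r_neg)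
  then have "m \<oplus>\<^bsub>M\<^esub> \<ominus>\<^bsub>M\<^esub> n = \<zero>\<^bsub>M\<^esub>" using s_inj assms by simp
  then show ?thesis using assms by (simp add: M.add_minus_eq_zero_iff)
qed

text \<open>If \<open>c\<close> kills \<open>x\<close>, it kills \<open>s \<odot> m\<close>, a
  multiple of \<open>x\<close>, and then injectivity of \<open>s\<close> gives that it kills
  \<open>m\<close>. Consequently R x is a copy of R modulo the annihilator.\<close>

lemma annihilator_eq: "annihilator R M = elem_annihilator R M x"
proof
  show "elem_annihilator R M x \<subseteq> annihilator R M"
  proof
    fix c assume "c \<in> elem_annihilator R M x"
    then have c: "c \<in> carrier R" "c \<odot>\<^bsub>M\<^esub> x = \<zero>\<^bsub>M\<^esub>" by (auto simp: elem_annihilator_def)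
    have "c \<odot>\<^bsub>M\<^esub> m = \<zero>\<^bsub>M\<^esub>" if m: "m \<in> carrier M" for m
    proof -
      obtain r where r: "r \<in> carrier R" "s \<odot>\<^bsub>M\<^esub> m = r \<odot>\<^bsub>M\<^esub> x" using s_cyclic[OF m] by blast
      have "s \<odot>\<^bsub>M\<^esub> (c \<odot>\<^bsub>M\<^esub> m) = c \<odot>\<^bsub>M\<^esub> (r \<odot>\<^bsub>M\<^esub> x)"
        using smult_left_commute c s_closed m r by metis
      also have "\<dots> = r \<odot>\<^bsub>M\<^esub> (c \<odot>\<^bsub>M\<^esub> x)" by (rule smult_left_commute[OF c(1) r(1) x_closed])
      finally show ?thesis using c r m s_inj by simp
    qed
    then show "c \<in> annihilator R M" using c by (simp add: annihilator_def)
  qed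
qed (rule annihilator_subset_elem_annihilator[OF x_closed])

text \<open>The composite of M with sM inside R x, and of R x with R/I: an element \<open>m\<close>
  goes to the coset of any \<open>r\<close> with \<open>s \<odot> m = r \<odot> x\<close>.\<close>

lemma isomorphic_to_ideal:
  "\<exists>J. ideal J (R Quot annihilator R M) \<and>
    module_isomorphic R M (quot_ideal_module R (annihilator R M) J)"
proof -
  define I where "I = annihilator R M"
  have I: "ideal I R" unfolding I_def by (rule ideal_annihilator)
  interpret I: ideal I R by (rule I)
  have coset_eq: "I +> r = I +> t \<longleftrightarrow> r \<odot>\<^bsub>M\<^esub> x = t \<odot>\<^bsub>M\<^esub> x" if "r \<in> carrier R" "t \<in> carrier R" for r t
  proof -
    have "r \<ominus> t \<in> I \<longleftrightarrow> r \<odot>\<^bsub>M\<^esub> x \<oplus>\<^bsub>M\<^esub> \<ominus>\<^bsub>M\<^esub> (t \<odot>\<^bsub>M\<^esub> x) = \<zero>\<^bsub>M\<^esub>"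
      unfolding I_def annihilator_eq using that x_closed
      by (simp add: elem_annihilator_def R.minus_eq smult_l_distr smult_l_minus)
    also have "\<dots> \<longleftrightarrow> r \<odot>\<^bsub>M\<^esub> x = t \<odot>\<^bsub>M\<^esub> x"
      using that x_closed by (simp add: M.add_minus_eq_zero_iff)
    finally show ?thesis using R.quotient_eq_iff_same_a_r_cos[OF I that] by simp
  qed
  \<comment> \<open>The choice \<open>q\<close> need not be linear. Only its coset modulo
    \<open>I\<close> is determined, and \<open>f_eqI\<close> lets any other scalar take its
    place.\<close>
  obtain q where q: "\<And>m. m \<in> carrier M \<Longrightarrow> q m \<in> carrier R"
    "\<And>m. m \<in> carrier M \<Longrightarrow> s \<odot>\<^bsub>M\<^esub> m = q m \<odot>\<^bsub>M\<^esub> x"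
    using s_cyclic by metis
  define f where "f m = I +> q m" for m
  define K where "K = {r \<in> carrier R. \<exists>m \<in> carrier M. s \<odot>\<^bsub>M\<^esub> m = r \<odot>\<^bsub>M\<^esub> x}"
  have f_eqI: "f m = I +> r" if "m \<in> carrier M" "r \<in> carrier R" "s \<odot>\<^bsub>M\<^esub> m = r \<odot>\<^bsub>M\<^esub> x" for m r
    using that q coset_eq by (simp add: f_def)
  have sM: "submodule ((\<lambda>m. s \<odot>\<^bsub>M\<^esub> m) ` carrier M) R M"
  proof (rule submoduleI)
    show "r \<odot>\<^bsub>M\<^esub> n \<in> (\<lambda>m. s \<odot>\<^bsub>M\<^esub> m) ` carrier M"
      if "r \<in> carrier R" "n \<in> (\<lambda>m. s \<odot>\<^bsub>M\<^esub> m) ` carrier M" for r n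
      using that smult_left_commute[OF _ s_closed] by auto
    show "\<zero>\<^bsub>M\<^esub> \<in> (\<lambda>m. s \<odot>\<^bsub>M\<^esub> m) ` carrier M"
      by (rule image_eqI[of _ _ "\<zero>\<^bsub>M\<^esub>"]) (simp_all add: s_closed)
  qed (use s_closed in \<open>auto simp flip: smult_r_distr smult_r_minus\<close>)
  \<comment> \<open>The preimage in R of the image ideal is the colon ideal (sM : x); in particular
    it is an ideal.\<close>
  have "K = colon R M ((\<lambda>m. s \<odot>\<^bsub>M\<^esub> m) ` carrier M) x" by (force simp: K_def colon_def)
  then have K: "ideal K R" using ideal_colon[OF sM x_closed] by simp
  define J where "J = (+>) I ` K"
  have J: "ideal J (R Quot I)" unfolding J_def by (rule R.ring_ideal_imp_quot_ideal[OF I K])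
  have hom: "f \<in> module_hom R M (quot_ideal_module R I J)"
    unfolding module_hom_def
  proof (intro CollectI conjI ballI Pi_I)
    fix m assume m: "m \<in> carrier M"
    then have "q m \<in> K" using q by (auto simp: K_def)
    then show "f m \<in> carrier (quot_ideal_module R I J)" by (simp add: f_def J_def quot_ideal_module_def)
    show "f (r \<odot>\<^bsub>M\<^esub> m) = r \<odot>\<^bsub>quot_ideal_module R I J\<^esub> f m" if r: "r \<in> carrier R" for r
    proof -
      have "s \<odot>\<^bsub>M\<^esub> (r \<odot>\<^bsub>M\<^esub> m) = (r \<otimes> q m) \<odot>\<^bsub>M\<^esub> x"
        using r m q(1)[OF m] q(2)[OF m] x_closed by (simp add: smult_left_commute[OF s_closed] smult_assoc1)
      then have "f (r \<odot>\<^bsub>M\<^esub> m) = I +> (r \<otimes> q m)" using r m q by (intro f_eqI) auto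
      then show ?thesis using r q m I.rcoset_mult_add
        by (simp add: quot_ideal_module_def FactRing_def f_def)
    qed
  next
    fix m n assume mn: "m \<in> carrier M" "n \<in> carrier M"
    have "s \<odot>\<^bsub>M\<^esub> (m \<oplus>\<^bsub>M\<^esub> n) = (q m \<oplus> q n) \<odot>\<^bsub>M\<^esub> x"
      using mn q[OF mn(1)] q[OF mn(2)] x_closed s_closed by (simp add: smult_r_distr smult_l_distr)
    then have "f (m \<oplus>\<^bsub>M\<^esub> n) = I +> (q m \<oplus> q n)" using mn q by (intro f_eqI) auto
    then show "f (m \<oplus>\<^bsub>M\<^esub> n) = f m \<oplus>\<^bsub>quot_ideal_module R I J\<^esub> f n"
      using q mn I.a_rcos_sum by (simp add: quot_ideal_module_def FactRing_def f_def)
  qed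
  have "bij_betw f (carrier M) J"
    unfolding bij_betw_def
  proof
    show "inj_on f (carrier M)"
    proof (rule inj_onI)
      fix m n assume mn: "m \<in> carrier M" "n \<in> carrier M" and "f m = f n"
      then have "q m \<odot>\<^bsub>M\<^esub> x = q n \<odot>\<^bsub>M\<^esub> x" using coset_eq q by (simp add: f_def)
      then show "m = n" using s_cancel mn q by simp
    qed
    show "f ` carrier M = J"
    proof
      show "f ` carrier M \<subseteq> J" using q by (auto simp: f_def J_def K_def)
      show "J \<subseteq> f ` carrier M" using f_eqI by (auto simp: J_def K_def intro!: image_eqI)
    qed
  qed
  then have "module_isomorphic R M (quot_ideal_module R I J)"
    using hom unfolding module_isomorphic_def by (auto simp: quot_ideal_module_def)
  then show ?thesis using J I_def by auto
qed

text \<open>The scalar is read off at \<open>x\<close>, from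
  \<open>s \<odot> f x = a \<odot> x\<close>. For general \<open>m\<close> only
  \<open>s \<odot> m\<close> is a multiple of \<open>x\<close>, so the identity is first shown after
  a further multiplication by \<open>s\<close>, which is then cancelled.\<close>

lemma End_multiplier:
  assumes "f \<in> carrier (End_ring R M)"
  obtains a where "a \<in> carrier R" and "\<And>m. m \<in> carrier M \<Longrightarrow> s \<odot>\<^bsub>M\<^esub> f m = a \<odot>\<^bsub>M\<^esub> m"
proof -
  have f: "\<And>m. m \<in> carrier M \<Longrightarrow> f m \<in> carrier M"
    "\<And>r m. r \<in> carrier R \<Longrightarrow> m \<in> carrier M \<Longrightarrow> f (r \<odot>\<^bsub>M\<^esub> m) = r \<odot>\<^bsub>M\<^esub> f m"
    using assms by (auto simp: End_ring_def module_hom_def)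
  obtain a where a: "a \<in> carrier R" "s \<odot>\<^bsub>M\<^esub> f x = a \<odot>\<^bsub>M\<^esub> x"
    using s_cyclic[OF f(1)[OF x_closed]] by blast
  have "s \<odot>\<^bsub>M\<^esub> f m = a \<odot>\<^bsub>M\<^esub> m" if m: "m \<in> carrier M" for m
  proof (rule s_cancel)
    obtain r where r: "r \<in> carrier R" "s \<odot>\<^bsub>M\<^esub> m = r \<odot>\<^bsub>M\<^esub> x" using s_cyclic[OF m] by blast
    have "s \<odot>\<^bsub>M\<^esub> (s \<odot>\<^bsub>M\<^esub> f m) = s \<odot>\<^bsub>M\<^esub> f (r \<odot>\<^bsub>M\<^esub> x)"
      using f(2)[OF s_closed m] r by simp
    also have "\<dots> = r \<odot>\<^bsub>M\<^esub> (a \<odot>\<^bsub>M\<^esub> x)"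
      using f r a x_closed s_closed by (simp add: smult_left_commute[of s r])
    also have "\<dots> = a \<odot>\<^bsub>M\<^esub> (s \<odot>\<^bsub>M\<^esub> m)"
      using r a x_closed by (simp add: smult_left_commute[of r a])
    also have "\<dots> = s \<odot>\<^bsub>M\<^esub> (a \<odot>\<^bsub>M\<^esub> m)" by (rule smult_left_commute[OF a(1) s_closed m])
    finally show "s \<odot>\<^bsub>M\<^esub> (s \<odot>\<^bsub>M\<^esub> f m) = s \<odot>\<^bsub>M\<^esub> (a \<odot>\<^bsub>M\<^esub> m)" .
  qed (use m f s_closed a in auto)
  with a show thesis using that by blast
qed

lemma End_ring_apply_closed: "\<lbrakk>f \<in> carrier (End_ring R M); m \<in> carrier M\<rbrakk> \<Longrightarrow> f m \<in> carrier M"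
  by (auto simp: End_ring_def module_hom_def)

lemma cring_End_ring: "cring (End_ring R M)"
proof -
  interpret E: ring "End_ring R M" by (rule ring_End_ring)
  have "f \<otimes>\<^bsub>End_ring R M\<^esub> g = g \<otimes>\<^bsub>End_ring R M\<^esub> f"
    if f: "f \<in> carrier (End_ring R M)" and g: "g \<in> carrier (End_ring R M)" for f g
  proof -
    obtain a where a: "a \<in> carrier R" "\<And>m. m \<in> carrier M \<Longrightarrow> s \<odot>\<^bsub>M\<^esub> f m = a \<odot>\<^bsub>M\<^esub> m"
      using End_multiplier[OF f] by blast
    obtain b where b: "b \<in> carrier R" "\<And>m. m \<in> carrier M \<Longrightarrow> s \<odot>\<^bsub>M\<^esub> g m = b \<odot>\<^bsub>M\<^esub> m"
      using End_multiplier[OF g] by blast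
    \<comment> \<open>Twice multiplied by \<open>s\<close>, the two sides are \<open>m\<close> times
      the products of \<open>a\<close> and \<open>b\<close> in either order; hence two cancellations
      of \<open>s\<close>.\<close>
    have "f (g m) = g (f m)" if m: "m \<in> carrier M" for m
    proof (rule s_cancel[OF _ _ s_cancel])
      have gm: "g m \<in> carrier M" and fm: "f m \<in> carrier M"
        by (rule End_ring_apply_closed[OF g m], rule End_ring_apply_closed[OF f m])
      show fgm: "f (g m) \<in> carrier M" and gfm: "g (f m) \<in> carrier M"
        by (rule End_ring_apply_closed[OF f gm], rule End_ring_apply_closed[OF g fm])
      then show "s \<odot>\<^bsub>M\<^esub> f (g m) \<in> carrier M" "s \<odot>\<^bsub>M\<^esub> g (f m) \<in> carrier M"
        using s_closed by simp_all
      have "s \<odot>\<^bsub>M\<^esub> (s \<odot>\<^bsub>M\<^esub> f (g m)) = a \<odot>\<^bsub>M\<^esub> (b \<odot>\<^bsub>M\<^esub> m)"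
        unfolding a(2)[OF gm] smult_left_commute[OF s_closed a(1) gm] b(2)[OF m] ..
      also have "\<dots> = b \<odot>\<^bsub>M\<^esub> (a \<odot>\<^bsub>M\<^esub> m)" by (rule smult_left_commute[OF a(1) b(1) m])
      also have "\<dots> = s \<odot>\<^bsub>M\<^esub> (s \<odot>\<^bsub>M\<^esub> g (f m))"
        unfolding b(2)[OF fm] smult_left_commute[OF s_closed b(1) fm] a(2)[OF m] ..
      finally show "s \<odot>\<^bsub>M\<^esub> (s \<odot>\<^bsub>M\<^esub> f (g m)) = s \<odot>\<^bsub>M\<^esub> (s \<odot>\<^bsub>M\<^esub> g (f m))" .
    qed
    then show ?thesis by (auto simp: End_ring_def compose_def)
  qed
  then show ?thesis
    by (intro cring.intro E.ring_axioms comm_monoid.intro E.monoid_axioms comm_monoid_axioms.intro)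
qed

text \<open>If \<open>s\<close> times \<open>f\<close> acts as \<open>a\<close>, then the k-th power
  of \<open>s\<close> times that of \<open>f\<close> acts as the k-th power of \<open>a\<close>. A
  nilpotent \<open>f\<close> thus puts a power of \<open>a\<close> into the annihilator; radicality
  gives \<open>a\<close> itself, and cancelling \<open>s\<close> gives f = 0.\<close>

lemma reduced_ring_End_ring:
  assumes rad: "radical_ideal (annihilator R M) R"
  shows "reduced_ring (End_ring R M)"
proof -
  interpret E: ring "End_ring R M" by (rule ring_End_ring)
  have "f = \<zero>\<^bsub>End_ring R M\<^esub>"
    if f: "f \<in> carrier (End_ring R M)" and nil: "f [^]\<^bsub>End_ring R M\<^esub> n = \<zero>\<^bsub>End_ring R M\<^esub>" for f and n :: nat
  proof -
    obtain a where a: "a \<in> carrier R" "\<And>m. m \<in> carrier M \<Longrightarrow> s \<odot>\<^bsub>M\<^esub> f m = a \<odot>\<^bsub>M\<^esub> m"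
      using End_multiplier[OF f] by blast
    have pow: "(s [^] k) \<odot>\<^bsub>M\<^esub> (f [^]\<^bsub>End_ring R M\<^esub> k) m = (a [^] k) \<odot>\<^bsub>M\<^esub> m"
      if "m \<in> carrier M" for k :: nat and m
      using that
    proof (induction k arbitrary: m)
      case 0
      then show ?case by (simp add: End_ring_def)
    next
      case (Suc k)
      have fm: "f m \<in> carrier M" using f Suc.prems by (rule End_ring_apply_closed)
      have fk: "(f [^]\<^bsub>End_ring R M\<^esub> k) (f m) \<in> carrier M"
        using E.nat_pow_closed[OF f] fm by (rule End_ring_apply_closed)
      \<comment> \<open>Powers grow by a factor on the right, so the induction hypothesis is used at
        \<open>f m\<close>; this is why \<open>m\<close> is generalized.\<close>
      have "(f [^]\<^bsub>End_ring R M\<^esub> Suc k) m = (f [^]\<^bsub>End_ring R M\<^esub> k) (f m)"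
        using Suc.prems by (simp add: End_ring_def compose_def)
      then have "(s [^] Suc k) \<odot>\<^bsub>M\<^esub> (f [^]\<^bsub>End_ring R M\<^esub> Suc k) m
        = s \<odot>\<^bsub>M\<^esub> ((s [^] k) \<odot>\<^bsub>M\<^esub> (f [^]\<^bsub>End_ring R M\<^esub> k) (f m))"
        using s_closed fk by (simp add: smult_assoc1 smult_left_commute[of s "s [^] k"] del: E.nat_pow_Suc)
      also have "\<dots> = (a [^] k) \<odot>\<^bsub>M\<^esub> (s \<odot>\<^bsub>M\<^esub> f m)"
        using Suc.IH[OF fm] a(1) s_closed fm by (simp add: smult_left_commute)
      also have "\<dots> = (a [^] Suc k) \<odot>\<^bsub>M\<^esub> m" using a Suc.prems by (simp add: smult_assoc1)
      finally show ?case .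
    qed
    have "(a [^] n) \<odot>\<^bsub>M\<^esub> m = \<zero>\<^bsub>M\<^esub>" if "m \<in> carrier M" for m
      using pow[OF that, of n] that s_closed unfolding nil by (simp add: End_ring_def)
    then have "a [^] n \<in> annihilator R M" using a by (simp add: annihilator_def)
    then have "a \<in> annihilator R M" using rad a(1) unfolding radical_ideal_def ideal_radical_def by blast
    then have "s \<odot>\<^bsub>M\<^esub> f m = \<zero>\<^bsub>M\<^esub>" if "m \<in> carrier M" for m
      using a(2) that by (simp add: annihilator_def)
    then have "f m = \<zero>\<^bsub>M\<^esub>" if "m \<in> carrier M" for m
      using s_inj End_ring_apply_closed[OF f] that by blast
    then show ?thesis using f by (intro extensionalityI[where A = "carrier M"]) (auto simp: End_ring_def)
  qed
  then show ?thesis using E.ring_axioms by (auto simp: reduced_ring_def)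
qed

end

theorem theorem7p9:
  fixes R :: "('a, 'c) ring_scheme" and M :: "('a, 'b, 'd) module_scheme"
  assumes "cring R"
    and "noetherian_ring R"
    and "krull_dim R < \<infinity>"
    and "module R M"
    and "finitely_generated_module R M"
    and "binary_module R M"
    and "embedded_primes R M = {}"
  shows "radical_ideal (annihilator R M) R
    \<and> (\<exists>J. ideal J (R Quot annihilator R M)
          \<and> module_isomorphic R M (quot_ideal_module R (annihilator R M) J))
    \<and> cring (End_ring R M)
    \<and> reduced_ring (End_ring R M)"
proof -
  interpret module R M by (rule assms(4))
  obtain x s where x: "x \<in> carrier M" and s: "s \<in> carrier R"
    and cyclic: "\<And>m. m \<in> carrier M \<Longrightarrow> \<exists>r \<in> carrier R. s \<odot>\<^bsub>M\<^esub> m = r \<odot>\<^bsub>M\<^esub> x"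
    and inj: "\<And>m. \<lbrakk>m \<in> carrier M; s \<odot>\<^bsub>M\<^esub> m = \<zero>\<^bsub>M\<^esub>\<rbrakk> \<Longrightarrow> m = \<zero>\<^bsub>M\<^esub>"
    and kill: "\<And>c. \<lbrakk>c \<in> carrier R; \<forall>P \<in> associated_primes R M. c \<in> P\<rbrakk> \<Longrightarrow> c \<odot>\<^bsub>M\<^esub> x = \<zero>\<^bsub>M\<^esub>"
    using binary_embedding_data[OF assms(2,5,6,7)] by blast
  interpret module_embedded_in_cyclic R M x s
    by unfold_locales (fact x s cyclic inj)+
  \<comment> \<open>A power of \<open>c\<close> in the annihilator puts \<open>c\<close> into every
    associated prime, so \<open>c\<close> kills \<open>x\<close>, and the annihilator of
    \<open>x\<close> is that of M.\<close>
  have "c \<in> annihilator R M" if c: "c \<in> carrier R" "c [^]\<^bsub>R\<^esub> n \<in> annihilator R M" for c and n :: nat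
  proof -
    have "c \<in> P" if P: "P \<in> associated_primes R M" for P
    proof -
      from P obtain y where y: "primeideal P R" "y \<in> carrier M" "P = elem_annihilator R M y"
        by (auto simp: associated_primes_def)
      have "c [^]\<^bsub>R\<^esub> n \<in> P"
        using subsetD[OF annihilator_subset_elem_annihilator[OF y(2)] c(2)] unfolding y(3) .
      then show ?thesis by (rule primeideal.pow_mem_imp_mem[OF y(1) c(1)])
    qed
    then have "c \<odot>\<^bsub>M\<^esub> x = \<zero>\<^bsub>M\<^esub>" using kill[OF c(1)] by blast
    then show ?thesis using c(1) unfolding annihilator_eq by (simp add: elem_annihilator_def)
  qed
  moreover have "c \<in> ideal_radical R (annihilator R M)" if "c \<in> annihilator R M" for c
    using that ideal.Icarr[OF ideal_annihilator that] R.nat_pow_eone unfolding ideal_radical_def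
    by (intro CollectI conjI exI[of _ 1]) auto
  ultimately have rad: "radical_ideal (annihilator R M) R"
    using ideal_annihilator unfolding radical_ideal_def ideal_radical_def by blast
  show ?thesis
    using rad isomorphic_to_ideal cring_End_ring reduced_ring_End_ring[OF rad] by blast
qed

end
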